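(* Let $D_1$ and $D_2$ be spheres of radius $r_1>0$ and $r_2>0$, respectively, in $\mathbb{R}^3$, separated by a distance $\epsilon>0$. Then the capacitance coefficients are given by \[ C_{11}=8\pi\alpha\sum_{n=0}^{\infty}\frac{e^{(2n+1)\xi_2}}{e^{(2n+1)(\xi_1+\xi_2)}-1},\qquad C_{22}=8\pi\alpha\sum_{n=0}^{\infty}\frac{e^{(2n+1)\xi_1}}{e^{(2n+1)(\xi_1+\xi_2)}-1}, \] \[ C_{12}=C_{21}=-8\pi\alpha\sum_{n=0}^{\infty}\frac{1}{e^{(2n+1)(\xi_1+\xi_2)}-1}, \] where \[ \alpha=\frac{\sqrt{\epsilon(2r_1+\epsilon)(2r_2+\epsilon)(2r_1+2r_2+\epsilon)}}{2(r_1+r_2+\epsilon)},\qquad \xi_i=\sinh^{-1}\left(\frac{\alpha}{r_i}\right),\quad i=1,2. \]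
   Context: $D_1,D_2$ are disjoint balls whose centres are at distance $r_1+r_2+\epsilon$, and $D=D_1\cup D_2$. The Laplace single layer potential is \[ \mathcal{S}_D[\phi](x)=-\frac{1}{4\pi}\int_{\partial D}\frac{\phi(y)}{|x-y|}\,\mathrm{d}\sigma(y),\qquad \phi\in L^2(\partial D), \] which is invertible from $L^2(\partial D)$ to $H^1(\partial D)$. The functions $\psi_1,\psi_2\in L^2(\partial D)$ are defined by $\mathcal{S}_D[\psi_j]=\delta_{ij}$ on $\partial D_i$, $i,j=1,2$ ($\delta_{ij}$ the Kronecker delta). The capacitance coefficients are \[ C_{ij}=-\int_{\partial D_i}\psi_j\,\mathrm{d}\sigma,\qquad i,j=1,2. \] *)

theory Defs
  imports "HOL-Analysis.Analysis"
begin

text \<open>Surface measure of the sphere of radius \<open>r\<close> about \<open>c\<close>, as a Borel measure on the whole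
  space: the image of \<open>r\<^sup>2 sin \<theta> d\<theta> d\<phi>\<close> on \<open>[0, \<pi>] \<times> [0, 2\<pi>]\<close> under spherical coordinates.\<close>

definition sphere_param :: "real^3 \<Rightarrow> real \<Rightarrow> real \<times> real \<Rightarrow> real^3" where
  "sphere_param c r =
     (\<lambda>(\<theta>, \<phi>). c + r *\<^sub>R vector [sin \<theta> * cos \<phi>, sin \<theta> * sin \<phi>, cos \<theta>])"

definition sphere_area :: "real^3 \<Rightarrow> real \<Rightarrow> (real^3) measure" where
  "sphere_area c r =
     distr
       (density lborel
         (\<lambda>(\<theta>, \<phi>). indicator ({0..pi} \<times> {0..2*pi}) (\<theta>, \<phi>) * ennreal (r\<^sup>2 * sin \<theta>)))
       borel (sphere_param c r)"

text \<open>Surface measure on the boundary of \<open>ball (c 1) (r 1) \<union> ball (c 2) (r 2)\<close>, for balls with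
  disjoint closures. Here and below only the indices \<open>1\<close> and \<open>2\<close> are relevant.\<close>

definition bdry_area :: "(nat \<Rightarrow> real^3) \<Rightarrow> (nat \<Rightarrow> real) \<Rightarrow> (real^3) measure" where
  "bdry_area c r =
     measure_of UNIV (sets borel) (\<lambda>A. \<Sum>i\<in>{1, 2}. emeasure (sphere_area (c i) (r i)) A)"

lemma sets_sphere_area [simp, measurable_cong]: "sets (sphere_area c r) = sets borel"
  by (simp add: sphere_area_def)

lemma space_sphere_area [simp]: "space (sphere_area c r) = UNIV"
  by (simp add: sphere_area_def)

lemma sets_bdry_area [simp, measurable_cong]: "sets (bdry_area c r) = sets borel"
  unfolding bdry_area_def using sets.sigma_sets_eq[of "borel :: (real^3) measure"] by simp

lemma space_bdry_area [simp]: "space (bdry_area c r) = UNIV"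
  by (simp add: bdry_area_def space_measure_of_conv)

lemma emeasure_bdry_area:
  assumes "A \<in> sets borel"
  shows "emeasure (bdry_area c r) A =
    emeasure (sphere_area (c 1) (r 1)) A + emeasure (sphere_area (c 2) (r 2)) A"
proof -
  have "countably_additive (sets (borel :: (real^3) measure))
      (\<lambda>A. \<Sum>i\<in>{1, 2}. emeasure (sphere_area (c i) (r i)) A)"
  proof (rule countably_additiveI)
    fix F :: "nat \<Rightarrow> (real^3) set"
    assume F: "range F \<subseteq> sets borel" "disjoint_family F"
    have "(\<Sum>n. \<Sum>i\<in>{1, 2}. emeasure (sphere_area (c i) (r i)) (F n)) =
        (\<Sum>i\<in>{1, 2}. \<Sum>n. emeasure (sphere_area (c i) (r i)) (F n))"
      by (rule suminf_sum) simp
    also have "\<dots> = (\<Sum>i\<in>{1, 2}. emeasure (sphere_area (c i) (r i)) (\<Union> (range F)))"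
      using F by (intro sum.cong refl suminf_emeasure) auto
    finally show "(\<Sum>n. \<Sum>i\<in>{1, 2}. emeasure (sphere_area (c i) (r i)) (F n)) =
        (\<Sum>i\<in>{1, 2}. emeasure (sphere_area (c i) (r i)) (\<Union> (range F)))" .
  qed
  then have "countably_additive (sets (bdry_area c r))
      (\<lambda>A. \<Sum>i\<in>{1, 2}. emeasure (sphere_area (c i) (r i)) A)"
    by (simp only: sets_bdry_area)
  then have "emeasure (bdry_area c r) A =
      (\<Sum>i\<in>{1, 2}. emeasure (sphere_area (c i) (r i)) A)"
    using assms
    by (intro emeasure_measure_of[OF bdry_area_def]) (auto simp: positive_def)
  then show ?thesis by simp
qed

lemma sphere_param_measurable [measurable]: "sphere_param c r \<in> borel_measurable borel"
proof -
  have "vector [x, y, z] = x *\<^sub>R axis 1 1 + y *\<^sub>R axis 2 1 + z *\<^sub>R (axis 3 1 :: real^3)"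
    for x y z :: real
    by (simp add: vec_eq_iff forall_3 axis_def)
  then have "sphere_param c r = (\<lambda>p. c + r *\<^sub>R ((sin (fst p) * cos (snd p)) *\<^sub>R axis 1 1
      + (sin (fst p) * sin (snd p)) *\<^sub>R axis 2 1 + cos (fst p) *\<^sub>R axis 3 1))"
    by (simp add: sphere_param_def fun_eq_iff)
  moreover have "continuous_on UNIV \<dots>"
    by (intro continuous_intros)
  ultimately show ?thesis
    by (simp add: borel_measurable_continuous_onI)
qed

lemma emeasure_sphere_area_UNIV: "emeasure (sphere_area c r) UNIV = ennreal (4 * pi * r\<^sup>2)"
proof -
  define f where "f = (\<lambda>\<theta>. indicator {0..pi} \<theta> * ennreal (r\<^sup>2 * sin \<theta>))"
  have f_int: "(\<integral>\<^sup>+ \<theta>. f \<theta> \<partial>lborel) = ennreal (2 * r\<^sup>2)"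
  proof -
    have "(\<integral>\<^sup>+ \<theta>. ennreal (r\<^sup>2 * sin \<theta>) * indicator {0..pi} \<theta> \<partial>lborel) =
        ennreal (- (r\<^sup>2 * cos pi) - (- (r\<^sup>2 * cos 0)))"
      by (rule nn_integral_FTC_Icc)
        (auto intro!: derivative_eq_intros mult_nonneg_nonneg sin_ge_zero)
    then show ?thesis by (simp add: f_def mult.commute)
  qed
  have [measurable]: "f \<in> borel_measurable borel" by (simp add: f_def)
  have eq: "(\<lambda>(\<theta>, \<phi>). indicator ({0..pi} \<times> {0..2*pi}) (\<theta>, \<phi>) * ennreal (r\<^sup>2 * sin \<theta>)) =
      (\<lambda>(\<theta>, \<phi>). f \<theta> * indicator {0..2*pi} \<phi>)"
    by (auto simp: f_def fun_eq_iff indicator_def)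
  have [measurable]: "(\<lambda>x. f (fst x) * indicator {0..2*pi} (snd x))
      \<in> borel_measurable (borel :: (real \<times> real) measure)"
    unfolding borel_prod[symmetric] by measurable
  have "emeasure (sphere_area c r) UNIV =
      (\<integral>\<^sup>+ p. (case p of (\<theta>, \<phi>) \<Rightarrow> f \<theta> * indicator {0..2*pi} \<phi>) \<partial>(lborel \<Otimes>\<^sub>M lborel))"
    unfolding sphere_area_def eq
    by (subst emeasure_distr) (auto simp: emeasure_density lborel_prod split_beta')
  also have "\<dots> = (\<integral>\<^sup>+ \<theta>. \<integral>\<^sup>+ \<phi>. f \<theta> * indicator {0..2*pi} \<phi> \<partial>lborel \<partial>lborel)"
    by (subst lborel.nn_integral_fst[symmetric]) auto
  also have "\<dots> = ennreal (2 * r\<^sup>2) * ennreal (2 * pi)"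
    by (simp add: nn_integral_cmult nn_integral_multc f_int)
  also have "\<dots> = ennreal (4 * pi * r\<^sup>2)"
    by (simp add: mult_ac flip: ennreal_mult)
  finally show ?thesis .
qed

definition square_integrable :: "'a measure \<Rightarrow> ('a \<Rightarrow> real) \<Rightarrow> bool" where
  "square_integrable M f \<longleftrightarrow> f \<in> borel_measurable M \<and> integrable M (\<lambda>x. (f x)\<^sup>2)"

text \<open>For square integrable \<open>\<phi>\<close> the integral converges only for almost every \<open>x\<close> on the
  boundary, so equations between values of the potential there are to be read almost everywhere.\<close>

definition single_layer :: "(real^3) measure \<Rightarrow> (real^3 \<Rightarrow> real) \<Rightarrow> real^3 \<Rightarrow> real" where
  "single_layer \<sigma> \<phi> x = - (1 / (4 * pi)) * (LINT y|\<sigma>. \<phi> y / norm (x - y))"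

text \<open>\<open>\<psi> j\<close> is the preimage under the single layer operator of the function that equals \<open>1\<close> on
  the boundary of the \<open>j\<close>-th ball and \<open>0\<close> on that of the other one.\<close>

definition capacitance_densities ::
  "(nat \<Rightarrow> real^3) \<Rightarrow> (nat \<Rightarrow> real) \<Rightarrow> (nat \<Rightarrow> real^3 \<Rightarrow> real) \<Rightarrow> bool" where
  "capacitance_densities c r \<psi> \<longleftrightarrow>
     (\<forall>j\<in>{1, 2}. square_integrable (bdry_area c r) (\<psi> j) \<and>
       (\<forall>i\<in>{1, 2}. AE x in bdry_area c r. x \<in> frontier (ball (c i) (r i)) \<longrightarrow>
          single_layer (bdry_area c r) (\<psi> j) x = (if i = j then 1 else 0)))"

definition capacitance_coeff ::
  "(nat \<Rightarrow> real^3) \<Rightarrow> (nat \<Rightarrow> real) \<Rightarrow> (nat \<Rightarrow> real^3 \<Rightarrow> real) \<Rightarrow> nat \<Rightarrow> nat \<Rightarrow> real" where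
  "capacitance_coeff c r \<psi> i j = - (LINT y : frontier (ball (c i) (r i)) | bdry_area c r. \<psi> j y)"

end

theory Submission
  imports Defs "HOL-Real_Asymp.Real_Asymp"
begin

text \<open>
  The densities \<open>\<psi> j\<close> are never constructed. Only their potentials are used, and those are known
  inside the balls: the single layer potential of a density is harmonic off the boundary, so on the
  \<open>i\<close>-th ball it is constant, equal to its boundary value \<open>\<delta>\<^sub>i\<^sub>j\<close>
  (\<open>single_layer_interior\<close>). As the boundary values are known only almost everywhere, this is
  proved by integrating them against the Poisson kernel and exchanging integrals. The fact of
  potential theory behind it is that sweeping a unit point charge at \<open>p\<close> out of a ball, onto the
  sphere with the Poisson kernel as density, does not change its Newtonian potential on and outside
  the sphere (\<open>poisson_kernel_reproduces_Newton\<close>).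

  Suppose now that point charges \<open>q n\<close> at points \<open>p n\<close> inside the two balls have the potential
  \<open>u x = (\<Sum>n. q n / norm (x - p n))\<close>, equal to \<open>1\<close> on the boundary of the \<open>i\<close>-th ball and to
  \<open>0\<close> on that of the other one. Then the integral of \<open>\<psi> j\<close> over the \<open>i\<close>-th boundary is the
  integral of \<open>u * \<psi> j\<close> over the whole boundary. Exchanging sum and integral, it is
  \<open>- 4 * pi\<close> times the sum of the \<open>q n\<close> weighted by the values of the potential of \<open>\<psi> j\<close> at
  \<open>p n\<close>, that is, the sum of those charges which sit in the \<open>j\<close>-th ball. Such charges are found
  by Kelvin's method of images. In the coordinate \<open>\<eta>\<close> in which the points of the axis are
  \<open>\<alpha> * coth \<eta>\<close>, the two spheres have their centres at \<open>- \<xi>i\<close> and \<open>\<xi>j\<close>, inversion in the sphere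
  centred at \<open>\<xi>\<close> is \<open>\<eta> \<mapsto> \<xi> - \<eta>\<close>, and a charge at \<open>\<eta>\<close> has size \<open>\<alpha> / sinh \<eta>\<close> up to sign
  (\<open>image_charge_cancels\<close>). The images are therefore in arithmetic progression, and the coefficients
  come out as series of reciprocals of \<open>sinh\<close> (\<open>sphere_charge_sums\<close>). Expanding each
  reciprocal into a geometric series and summing in the other order turns them into the stated
  series (\<open>Lambert_sums_sinh\<close>).
\<close>

section \<open>Rational integrals over a sphere\<close>

lemma nn_integral_sphere_area:
  assumes [measurable]: "f \<in> borel_measurable borel"
  shows "(\<integral>\<^sup>+ x. f x \<partial>sphere_area c r) =
    (\<integral>\<^sup>+ \<theta>. \<integral>\<^sup>+ \<phi>. f (sphere_param c r (\<theta>, \<phi>)) * indicator {0..2*pi} \<phi> \<partial>lborel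
       * (ennreal (r\<^sup>2 * sin \<theta>) * indicator {0..pi} \<theta>) \<partial>lborel)"
proof -
  have eq: "(\<lambda>(\<theta>, \<phi>). indicator ({0..pi} \<times> {0..2*pi}) (\<theta>, \<phi>) * ennreal (r\<^sup>2 * sin \<theta>)) =
      (\<lambda>(\<theta>, \<phi>). indicator {0..2*pi} \<phi> * (ennreal (r\<^sup>2 * sin \<theta>) * indicator {0..pi} \<theta>))"
    by (auto simp: fun_eq_iff indicator_def)
  have [measurable]: "(\<lambda>x. f (sphere_param c r x)) \<in> borel_measurable (borel \<Otimes>\<^sub>M borel)"
    unfolding borel_prod by measurable
  have [measurable]: "(\<lambda>(\<theta>, \<phi>). indicator {0..2*pi} \<phi> *
      (ennreal (r\<^sup>2 * sin \<theta>) * indicator {0..pi} \<theta>)) \<in> borel_measurable (borel \<Otimes>\<^sub>M borel)"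
    by measurable
  have "(\<integral>\<^sup>+ x. f x \<partial>sphere_area c r) = (\<integral>\<^sup>+ x. f (sphere_param c r x) \<partial>density lborel
      (\<lambda>(\<theta>, \<phi>). indicator {0..2*pi} \<phi> * (ennreal (r\<^sup>2 * sin \<theta>) * indicator {0..pi} \<theta>)))"
    unfolding sphere_area_def eq
    by (subst nn_integral_distr) auto
  also have "\<dots> = (\<integral>\<^sup>+ x. (case x of (\<theta>, \<phi>) \<Rightarrow> indicator {0..2*pi} \<phi> *
      (ennreal (r\<^sup>2 * sin \<theta>) * indicator {0..pi} \<theta>)) * f (sphere_param c r x) \<partial>(lborel \<Otimes>\<^sub>M lborel))"
    unfolding lborel_prod
    by (subst nn_integral_density) (auto simp: borel_prod[symmetric])
  also have "\<dots> = (\<integral>\<^sup>+ \<theta>. \<integral>\<^sup>+ \<phi>. indicator {0..2*pi} \<phi> *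
      (ennreal (r\<^sup>2 * sin \<theta>) * indicator {0..pi} \<theta>) * f (sphere_param c r (\<theta>, \<phi>)) \<partial>lborel \<partial>lborel)"
    by (subst lborel.nn_integral_fst[symmetric]) auto
  also have "\<dots> = (\<integral>\<^sup>+ \<theta>. \<integral>\<^sup>+ \<phi>. f (sphere_param c r (\<theta>, \<phi>)) * indicator {0..2*pi} \<phi> *
      (ennreal (r\<^sup>2 * sin \<theta>) * indicator {0..pi} \<theta>) \<partial>lborel \<partial>lborel)"
    by (intro nn_integral_cong) (simp add: ac_simps)
  also have "\<dots> = (\<integral>\<^sup>+ \<theta>. \<integral>\<^sup>+ \<phi>. f (sphere_param c r (\<theta>, \<phi>)) * indicator {0..2*pi} \<phi> \<partial>lborel *
      (ennreal (r\<^sup>2 * sin \<theta>) * indicator {0..pi} \<theta>) \<partial>lborel)"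
    by (intro nn_integral_cong nn_integral_multc) measurable
  finally show ?thesis .
qed

text \<open>The usual tangent half-angle antiderivative jumps at odd multiples of \<open>pi\<close>. The one used here is
  smooth on the whole period. With \<open>C \<phi> = p * cos \<phi> + q * sin \<phi>\<close> and
  \<open>K\<^sup>2 = A\<^sup>2 - p\<^sup>2 - q\<^sup>2\<close>, the function \<open>1 / (A - C)\<close> has
  the antiderivative \<open>\<phi> / K + (2 / K) * arctan (- C' / (A + K - C))\<close>, whose second part is
  periodic; the square is reduced to it by the derivative of \<open>- C' / (A - C)\<close>.\<close>

lemma nn_integral_inverse_square_azimuth:
  fixes A p q :: real
  assumes "p\<^sup>2 + q\<^sup>2 < A\<^sup>2" "0 < A"
  shows "(\<integral>\<^sup>+ \<phi>. ennreal (1 / (A - (p * cos \<phi> + q * sin \<phi>))\<^sup>2) * indicator {0..2*pi} \<phi> \<partial>lborel)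
    = ennreal (2 * pi * A / sqrt (A\<^sup>2 - (p\<^sup>2 + q\<^sup>2)) ^ 3)"
proof -
  define K where "K = sqrt (A\<^sup>2 - (p\<^sup>2 + q\<^sup>2))"
  define C where "C = (\<lambda>\<phi>. p * cos \<phi> + q * sin \<phi>)"
  define S where "S = (\<lambda>\<phi>. p * sin \<phi> - q * cos \<phi>)"
  define G where "G = (\<lambda>\<phi>. (S \<phi> / (A - C \<phi>) +
      A * (\<phi> / K + 2 / K * arctan (S \<phi> / (A + K - C \<phi>)))) / K\<^sup>2)"
  have K: "K > 0" "K\<^sup>2 = A\<^sup>2 - (p\<^sup>2 + q\<^sup>2)" using assms by (auto simp: K_def)
  have CS: "(C \<phi>)\<^sup>2 + (S \<phi>)\<^sup>2 = p\<^sup>2 + q\<^sup>2" for \<phi>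
  proof -
    have "(C \<phi>)\<^sup>2 + (S \<phi>)\<^sup>2 = (p\<^sup>2 + q\<^sup>2) * ((sin \<phi>)\<^sup>2 + (cos \<phi>)\<^sup>2)"
      unfolding C_def S_def by algebra
    then show ?thesis by simp
  qed
  have AC: "A - C \<phi> > 0" for \<phi>
  proof -
    have "(C \<phi>)\<^sup>2 < A\<^sup>2" using CS[of \<phi>] assms(1) zero_le_power2[of "S \<phi>"] by linarith
    then show ?thesis using assms(2) by (simp add: power2_less_imp_less)
  qed
  have dC: "(C has_real_derivative - S \<phi>) (at \<phi>)" and dS: "(S has_real_derivative C \<phi>) (at \<phi>)" for \<phi>
    unfolding C_def S_def by (auto intro!: derivative_eq_intros)
  have dG: "(G has_real_derivative 1 / (A - C \<phi>)\<^sup>2) (at \<phi>)" for \<phi>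
  proof -
    define a where "a = A - C \<phi>"
    have a: "a > 0" and C: "C \<phi> = A - a" using AC[of \<phi>] by (auto simp: a_def)
    define s where "s = S \<phi>"
    have s: "s\<^sup>2 = 2 * A * a - a\<^sup>2 - K\<^sup>2" using CS[of \<phi>] unfolding K C s_def by algebra
    have q: "(a + K)\<^sup>2 + s\<^sup>2 = 2 * a * (A + K)" unfolding s by algebra
    have q0: "(a + K)\<^sup>2 + s\<^sup>2 > 0" using a K by (simp add: add_pos_nonneg)
    have dat: "((\<lambda>\<phi>. arctan (S \<phi> / (A + K - C \<phi>))) has_real_derivative
        ((A - a) * (a + K) - s\<^sup>2) / ((a + K)\<^sup>2 + s\<^sup>2)) (at \<phi>)"
    proof -
      have "((\<lambda>\<phi>. arctan (S \<phi> / (A + K - C \<phi>))) has_real_derivative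
        inverse (1 + (s / (a + K))\<^sup>2) * (((A - a) * (a + K) - s * s) / ((a + K) * (a + K)))) (at \<phi>)"
        using a K by (auto intro!: derivative_eq_intros dC dS simp: C s_def algebra_simps)
      also have "inverse (1 + (s / (a + K))\<^sup>2) * (((A - a) * (a + K) - s * s) / ((a + K) * (a + K)))
        = ((A - a) * (a + K) - s\<^sup>2) / ((a + K)\<^sup>2 + s\<^sup>2)"
      proof -
        have "1 + (s / (a + K))\<^sup>2 = ((a + K)\<^sup>2 + s\<^sup>2) / (a + K)\<^sup>2"
          using a K by (simp add: field_simps)
        then show ?thesis using a K q0 by (simp add: power2_eq_square)
      qed
      finally show ?thesis .
    qed
    have 1: "((A - a) * (a + K) - s\<^sup>2) / ((a + K)\<^sup>2 + s\<^sup>2) = (K - a) / (2 * a)"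
    proof -
      have "((A - a) * (a + K) - s\<^sup>2) = (K - a) * (A + K)" unfolding s by algebra
      then show ?thesis unfolding q using assms(2) K a by (simp)
    qed
    have "((\<lambda>\<phi>. S \<phi> / (A - C \<phi>)) has_real_derivative ((A - a) * a - s * s) / (a * a)) (at \<phi>)"
      using a by (auto intro!: derivative_eq_intros dC dS simp: C s_def)
    then have "(G has_real_derivative (((A - a) * a - s * s) / (a * a) +
      A * (1 / K + 2 / K * ((K - a) / (2 * a)))) / K\<^sup>2) (at \<phi>)"
      unfolding G_def
      by (intro DERIV_cdivide DERIV_add DERIV_cmult DERIV_ident dat[unfolded 1])
    also have "(((A - a) * a - s * s) / (a * a) +
      A * (1 / K + 2 / K * ((K - a) / (2 * a)))) / K\<^sup>2 = 1 / a\<^sup>2"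
    proof -
      have "1 / K + 2 / K * ((K - a) / (2 * a)) = 1 / a" using a K by (simp add: field_simps)
      moreover have "((A - a) * a - s * s) / (a * a) + A * (1 / a) = K\<^sup>2 / a\<^sup>2"
      proof -
        have "(A - a) * a - s * s + A * a = K\<^sup>2" using s by algebra
        then show ?thesis using a by (simp add: field_simps power2_eq_square)
      qed
      ultimately have "((A - a) * a - s * s) / (a * a) +
        A * (1 / K + 2 / K * ((K - a) / (2 * a))) = K\<^sup>2 / a\<^sup>2" by simp
      then show ?thesis using K(1) by simp
    qed
    finally show ?thesis by (simp add: a_def)
  qed
  have "(\<integral>\<^sup>+ \<phi>. ennreal (1 / (A - C \<phi>)\<^sup>2) * indicator {0..2*pi} \<phi> \<partial>lborel)
     = ennreal (G (2 * pi) - G 0)"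
    by (rule nn_integral_FTC_Icc) (use dG in \<open>auto simp: C_def\<close>)
  also have "G (2 * pi) - G 0 = 2 * pi * A / K ^ 3"
    unfolding G_def C_def S_def using K by (simp add: field_simps power2_eq_square power3_eq_cube)
  finally show ?thesis by (simp add: C_def K_def)
qed

text \<open>Archimedes' hat-box theorem in rotated coordinates would give this at once; here it is computed in the fixed
  spherical coordinates. After integration over the azimuth, the integrand in \<open>t = cos \<theta>\<close>
  is a linear function over the power \<open>3/2\<close> of a quadratic \<open>Q\<close>, whose antiderivative
  is a multiple of \<open>(a * t - z) / sqrt (Q t)\<close>.\<close>

lemma nn_integral_inverse_square_sphere:
  fixes b c :: "real^3"
  assumes "r > 0" "r * norm b < a"
  shows "(\<integral>\<^sup>+ x. ennreal (1 / (a - b \<bullet> (x - c))\<^sup>2) \<partial>sphere_area c r) =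
    ennreal (4 * pi * r\<^sup>2 / (a\<^sup>2 - r\<^sup>2 * (norm b)\<^sup>2))"
proof -
  define p where "p = r * b $ 1"
  define q where "q = r * b $ 2"
  define z where "z = r * b $ 3"
  have nb: "(r * norm b)\<^sup>2 = p\<^sup>2 + q\<^sup>2 + z\<^sup>2"
  proof -
    have "(norm b)\<^sup>2 = (b $ 1)\<^sup>2 + (b $ 2)\<^sup>2 + (b $ 3)\<^sup>2"
      by (simp add: power2_norm_eq_inner inner_vec_def sum_3 flip: power2_eq_square)
    then show ?thesis by (simp add: p_def q_def z_def power_mult_distrib algebra_simps)
  qed
  have a: "a > 0" using assms by (intro le_less_trans[OF _ assms(2)]) auto
  have lt: "p\<^sup>2 + q\<^sup>2 + z\<^sup>2 < a\<^sup>2" unfolding nb[symmetric]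
    using assms by (intro power_strict_mono) auto
  define Q where "Q = (\<lambda>t. (a - z * t)\<^sup>2 - (p\<^sup>2 + q\<^sup>2) * (1 - t\<^sup>2))"
  have Q: "Q t > 0" "a - z * t > 0" if "\<bar>t\<bar> \<le> 1" for t
  proof -
    have "\<bar>z\<bar> < a" using lt a 
      by (intro power2_less_imp_less[of "\<bar>z\<bar>" a]) (auto intro: le_less_trans[OF _ lt])
    have "\<bar>z * t\<bar> \<le> \<bar>z\<bar> * 1" unfolding abs_mult by (intro mult_left_mono that) auto
    then show pos: "a - z * t > 0" using \<open>\<bar>z\<bar> < a\<close> by linarith
    have t1: "0 \<le> 1 - t\<^sup>2" using that by (simp add: abs_square_le_1)
    have "Q t = (a - z * t)\<^sup>2 - (a\<^sup>2 - z\<^sup>2) * (1 - t\<^sup>2) + (a\<^sup>2 - (p\<^sup>2 + q\<^sup>2 + z\<^sup>2)) * (1 - t\<^sup>2)"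
      unfolding Q_def by (simp add: algebra_simps)
    also have "(a - z * t)\<^sup>2 - (a\<^sup>2 - z\<^sup>2) * (1 - t\<^sup>2) = (a * t - z)\<^sup>2"
      by (simp add: algebra_simps power2_eq_square)
    finally have Qt: "Q t = (a * t - z)\<^sup>2 + (a\<^sup>2 - (p\<^sup>2 + q\<^sup>2 + z\<^sup>2)) * (1 - t\<^sup>2)" .
    show "Q t > 0"
    proof (cases "\<bar>t\<bar> = 1")
      case True
      then have "t\<^sup>2 = 1" by (simp add: abs_square_eq_1)
      then show ?thesis unfolding Q_def using pos by simp
    next
      case False
      then have "1 - t\<^sup>2 > 0" using that by (simp add: abs_square_less_1)
      then show ?thesis unfolding Qt using lt by (intro add_nonneg_pos mult_pos_pos) auto
    qed
  qed
  define E where "E = a\<^sup>2 - r\<^sup>2 * (norm b)\<^sup>2"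
  have E: "E = a\<^sup>2 - (p\<^sup>2 + q\<^sup>2 + z\<^sup>2)" unfolding E_def nb[symmetric] by (simp add: power_mult_distrib)
  have E0: "E > 0" using lt by (simp add: E)
  define H where "H = (\<lambda>\<theta>. - (2 * pi * r\<^sup>2 / E) * ((a * cos \<theta> - z) / sqrt (Q (cos \<theta>))))"
  define h where "h = (\<lambda>\<theta>. 2 * pi * (a - z * cos \<theta>) / sqrt (Q (cos \<theta>)) ^ 3 * (r\<^sup>2 * sin \<theta>))"
  have dH: "(H has_real_derivative h \<theta>) (at \<theta>)" for \<theta>
  proof -
    define t where "t = cos \<theta>"
    define w where "w = sqrt (Q t)"
    have w: "w > 0" "w\<^sup>2 = Q t" using Q[of t] by (auto simp: w_def t_def)
    have dQ: "(Q has_real_derivative 2 * (- z * (a - z * t) + (p\<^sup>2 + q\<^sup>2) * t)) (at t)"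
      unfolding Q_def by (auto intro!: derivative_eq_intros simp: power2_eq_square algebra_simps)
    define N where "N = - z * (a - z * t) + (p\<^sup>2 + q\<^sup>2) * t"
    have Qt: "Q t > 0" using Q[of t] by (simp add: t_def)
    have dw: "((\<lambda>t. sqrt (Q t)) has_real_derivative N / w) (at t)"
    proof -
      have "((\<lambda>t. sqrt (Q t)) has_real_derivative inverse (sqrt (Q t)) / 2 * (2 * N)) (at t)"
        using DERIV_chain2[OF DERIV_real_sqrt[OF Qt] dQ] by (simp add: N_def)
      then show ?thesis by (simp add: w_def field_simps)
    qed
    have "((\<lambda>t. a * t - z) has_real_derivative a) (at t)"
      by (auto intro!: derivative_eq_intros)
    from DERIV_divide[OF this dw] have "((\<lambda>t. (a * t - z) / sqrt (Q t)) has_real_derivative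
       (a * w - (a * t - z) * (N / w)) / (w * w)) (at t)"
      using w(1) by (simp add: w_def)
    also have "(a * w - (a * t - z) * (N / w)) / (w * w) = (a * w\<^sup>2 - (a * t - z) * N) / w ^ 3"
      using w(1) by (simp add: field_simps power2_eq_square power3_eq_cube)
    also have "a * w\<^sup>2 - (a * t - z) * N = E * (a - z * t)"
      unfolding w(2) Q_def E N_def by (simp add: algebra_simps power2_eq_square)
    finally have d: "((\<lambda>t. (a * t - z) / sqrt (Q t)) has_real_derivative E * (a - z * t) / w ^ 3) (at (cos \<theta>))"
      by (simp add: t_def)
    have "(H has_real_derivative - (2 * pi * r\<^sup>2 / E) * (E * (a - z * t) / w ^ 3 * - sin \<theta>)) (at \<theta>)"
      unfolding H_def
      by (intro DERIV_cmult DERIV_chain2[where f="\<lambda>t. (a * t - z) / sqrt (Q t)" and g=cos, OF d DERIV_cos])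
    moreover have "- (2 * pi * r\<^sup>2 / E) * (E * (a - z * t) / w ^ 3 * - sin \<theta>) = h \<theta>"
      using E0 by (simp add: h_def w_def t_def)
    ultimately show ?thesis by simp
  qed
  have [measurable]: "h \<in> borel_measurable borel" unfolding h_def Q_def by measurable
  have "(\<integral>\<^sup>+ x. ennreal (1 / (a - b \<bullet> (x - c))\<^sup>2) \<partial>sphere_area c r) =
    (\<integral>\<^sup>+ \<theta>. (\<integral>\<^sup>+ \<phi>. ennreal (1 / (a - b \<bullet> (sphere_param c r (\<theta>, \<phi>) - c))\<^sup>2) * indicator {0..2*pi} \<phi> \<partial>lborel)
       * (ennreal (r\<^sup>2 * sin \<theta>) * indicator {0..pi} \<theta>) \<partial>lborel)"
    by (rule nn_integral_sphere_area) measurable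
  also have "\<dots> = (\<integral>\<^sup>+ \<theta>. ennreal (h \<theta>) * indicator {0..pi} \<theta> \<partial>lborel)"
  proof (rule nn_integral_cong)
    fix \<theta>
    have "(\<integral>\<^sup>+ \<phi>. ennreal (1 / (a - b \<bullet> (sphere_param c r (\<theta>, \<phi>) - c))\<^sup>2) * indicator {0..2*pi} \<phi> \<partial>lborel)
       * (ennreal (r\<^sup>2 * sin \<theta>)) = ennreal (h \<theta>)" if "\<theta> \<in> {0..pi}"
    proof -
      define A where "A = a - z * cos \<theta>"
      have s: "sin \<theta> \<ge> 0" using that by (auto intro: sin_ge_zero)
      have A: "A > 0" using Q[of "cos \<theta>"] by (simp add: A_def)
      have QA: "Q (cos \<theta>) = A\<^sup>2 - ((p * sin \<theta>)\<^sup>2 + (q * sin \<theta>)\<^sup>2)"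
        unfolding Q_def A_def by (simp add: sin_squared_eq power_mult_distrib algebra_simps)
      have arg: "a - b \<bullet> (sphere_param c r (\<theta>, \<phi>) - c) =
         A - ((p * sin \<theta>) * cos \<phi> + (q * sin \<theta>) * sin \<phi>)" for \<phi>
        by (simp add: sphere_param_def inner_vec_def sum_3 A_def p_def q_def z_def algebra_simps)
      have "(\<integral>\<^sup>+ \<phi>. ennreal (1 / (a - b \<bullet> (sphere_param c r (\<theta>, \<phi>) - c))\<^sup>2) * indicator {0..2*pi} \<phi> \<partial>lborel)
        = ennreal (2 * pi * A / sqrt (Q (cos \<theta>)) ^ 3)"
        unfolding arg QA
        by (rule nn_integral_inverse_square_azimuth) (use Q[of "cos \<theta>"] QA A in auto)
      then show ?thesis using A Q[of "cos \<theta>"] s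
        by (simp add: h_def A_def ennreal_mult[symmetric])
    qed
    then show "(\<integral>\<^sup>+ \<phi>. ennreal (1 / (a - b \<bullet> (sphere_param c r (\<theta>, \<phi>) - c))\<^sup>2) * indicator {0..2*pi} \<phi> \<partial>lborel)
       * (ennreal (r\<^sup>2 * sin \<theta>) * indicator {0..pi} \<theta>) = ennreal (h \<theta>) * indicator {0..pi} \<theta>"
      by (auto simp: indicator_def)
  qed
  also have "\<dots> = ennreal (H pi - H 0)"
  proof (rule nn_integral_FTC_Icc)
    fix \<theta> assume "\<theta> \<in> {0..pi}"
    then show "0 \<le> h \<theta>" using Q[of "cos \<theta>"] unfolding h_def
      by (intro mult_nonneg_nonneg divide_nonneg_nonneg sin_ge_zero zero_le_power) (use assms(1) in auto)
  qed (auto intro: dH DERIV_subset)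
  also have "H pi - H 0 = 4 * pi * r\<^sup>2 / E"
  proof -
    have q1: "sqrt (Q 1) = a - z" and q2: "sqrt (Q (- 1)) = a + z" and z: "a - z > 0" "a + z > 0"
      using Q[of 1] Q[of "-1"] by (auto simp: Q_def)
    have "(a * cos 0 - z) / sqrt (Q (cos 0)) = 1" using z by (simp add: q1)
    moreover have "(a * cos pi - z) / sqrt (Q (cos pi)) = - 1"
      using z by (simp add: q2 divide_eq_eq)
    ultimately show ?thesis unfolding H_def by (simp only:)
  qed
  finally show ?thesis by (simp add: E_def)
qed


section \<open>Rational integrals over the half-line\<close>

text \<open>Read from right to left, this writes \<open>A powr (- 3/2) * B powr (- 1/2)\<close> for
  \<open>A = a\<^sup>2\<close> and \<open>B = b\<^sup>2\<close> as an integral of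
  \<open>(A * u\<^sup>2 + B) powr (- 2)\<close>: a Feynman parametrisation, which merges two factors into one
  that is linear in both.\<close>

lemma nn_integral_inverse_quadratic_square:
  fixes a b :: real
  assumes "a > 0" "b > 0"
  shows "(\<integral>\<^sup>+ u. ennreal (2 * u\<^sup>2 / (a\<^sup>2 * u\<^sup>2 + b\<^sup>2)\<^sup>2) * indicator {0..} u \<partial>lborel)
    = ennreal (pi / (2 * a ^ 3 * b))"
proof -
  define F where "F = (\<lambda>u. arctan (a / b * u) / (a ^ 3 * b) - u / (a\<^sup>2 * (a\<^sup>2 * u\<^sup>2 + b\<^sup>2)))"
  have "(\<integral>\<^sup>+ u. ennreal (2 * u\<^sup>2 / (a\<^sup>2 * u\<^sup>2 + b\<^sup>2)\<^sup>2) * indicator {0..} u \<partial>lborel)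
    = ennreal (pi / 2 / (a ^ 3 * b) - 0 - F 0)"
  proof (rule nn_integral_FTC_atLeast)
    fix u :: real
    have q: "a\<^sup>2 * u\<^sup>2 + b\<^sup>2 > 0" using assms by (intro add_nonneg_pos) auto
    have d1: "((\<lambda>u. arctan (a / b * u)) has_real_derivative a * b / (a\<^sup>2 * u\<^sup>2 + b\<^sup>2)) (at u)"
    proof -
      have "((\<lambda>u. arctan (a / b * u)) has_real_derivative inverse (1 + (a / b * u)\<^sup>2) * (a / b)) (at u)"
        using assms by (auto intro!: derivative_eq_intros)
      moreover have "1 + (a / b * u)\<^sup>2 = (a\<^sup>2 * u\<^sup>2 + b\<^sup>2) / b\<^sup>2"
        using assms by (simp add: field_simps)
      ultimately show ?thesis using assms q by (simp add: power2_eq_square mult.commute)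
    qed
    have d2: "((\<lambda>u. u / (a\<^sup>2 * (a\<^sup>2 * u\<^sup>2 + b\<^sup>2))) has_real_derivative
        (a\<^sup>2 * (a\<^sup>2 * u\<^sup>2 + b\<^sup>2) - u * (a\<^sup>2 * (a\<^sup>2 * (2 * u)))) /
        (a\<^sup>2 * (a\<^sup>2 * u\<^sup>2 + b\<^sup>2) * (a\<^sup>2 * (a\<^sup>2 * u\<^sup>2 + b\<^sup>2)))) (at u)"
      using assms q by (auto intro!: derivative_eq_intros)
    have "(F has_real_derivative a * b / (a\<^sup>2 * u\<^sup>2 + b\<^sup>2) / (a ^ 3 * b) -
        (a\<^sup>2 * (a\<^sup>2 * u\<^sup>2 + b\<^sup>2) - u * (a\<^sup>2 * (a\<^sup>2 * (2 * u)))) /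
        (a\<^sup>2 * (a\<^sup>2 * u\<^sup>2 + b\<^sup>2) * (a\<^sup>2 * (a\<^sup>2 * u\<^sup>2 + b\<^sup>2)))) (at u)"
      unfolding F_def by (intro DERIV_diff DERIV_cdivide d1 d2)
    also have "a * b / (a\<^sup>2 * u\<^sup>2 + b\<^sup>2) / (a ^ 3 * b) -
        (a\<^sup>2 * (a\<^sup>2 * u\<^sup>2 + b\<^sup>2) - u * (a\<^sup>2 * (a\<^sup>2 * (2 * u)))) /
        (a\<^sup>2 * (a\<^sup>2 * u\<^sup>2 + b\<^sup>2) * (a\<^sup>2 * (a\<^sup>2 * u\<^sup>2 + b\<^sup>2)))
        = 2 * u\<^sup>2 / (a\<^sup>2 * u\<^sup>2 + b\<^sup>2)\<^sup>2"
    proof -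
      define w where "w = a\<^sup>2 * u\<^sup>2 + b\<^sup>2"
      have w: "w > 0" using q by (simp add: w_def)
      have "a * b / w / (a ^ 3 * b) = 1 / (a\<^sup>2 * w)"
        using assms w by (simp add: power2_eq_square power3_eq_cube)
      moreover have "(a\<^sup>2 * w - u * (a\<^sup>2 * (a\<^sup>2 * (2 * u)))) / (a\<^sup>2 * w * (a\<^sup>2 * w))
        = 1 / (a\<^sup>2 * w) - 2 * u\<^sup>2 / w\<^sup>2"
        using assms w by (simp add: diff_divide_distrib power2_eq_square)
      ultimately show ?thesis unfolding w_def[symmetric] by simp
    qed
    finally show "(F has_real_derivative 2 * u\<^sup>2 / (a\<^sup>2 * u\<^sup>2 + b\<^sup>2)\<^sup>2) (at u)" .
  next
    have "((\<lambda>u. arctan (a / b * u)) \<longlongrightarrow> pi / 2) at_top" using assms by real_asymp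
    moreover have "((\<lambda>u. u / (a\<^sup>2 * (a\<^sup>2 * u\<^sup>2 + b\<^sup>2))) \<longlongrightarrow> 0) at_top" using assms by real_asymp
    ultimately show "(F \<longlongrightarrow> pi / 2 / (a ^ 3 * b) - 0) at_top"
      unfolding F_def using assms by (intro tendsto_intros) auto
  qed auto
  then show ?thesis by (simp add: F_def mult.assoc)
qed

lemma nn_integral_inverse_quadratic:
  fixes a :: real
  assumes "a > 0"
  shows "(\<integral>\<^sup>+ u. ennreal (1 / (u\<^sup>2 + a\<^sup>2)) * indicator {0..} u \<partial>lborel) = ennreal (pi / (2 * a))"
proof -
  have "(\<integral>\<^sup>+ u. ennreal (1 / (u\<^sup>2 + a\<^sup>2)) * indicator {0..} u \<partial>lborel)
    = ennreal (pi / 2 / a - arctan (0 / a) / a)"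
  proof (rule nn_integral_FTC_atLeast)
    fix u :: real
    have q: "u\<^sup>2 + a\<^sup>2 > 0" using assms by (intro add_nonneg_pos) auto
    have "((\<lambda>u. arctan (u / a) / a) has_real_derivative inverse (1 + (u / a)\<^sup>2) * (1 / a) / a) (at u)"
      using assms by (auto intro!: derivative_eq_intros)
    moreover have "1 + (u / a)\<^sup>2 = (u\<^sup>2 + a\<^sup>2) / a\<^sup>2"
      using assms by (simp add: field_simps)
    ultimately show "((\<lambda>u. arctan (u / a) / a) has_real_derivative 1 / (u\<^sup>2 + a\<^sup>2)) (at u)"
      using assms q by (simp add: power2_eq_square)
  next
    have "((\<lambda>u. arctan (u / a)) \<longlongrightarrow> pi / 2) at_top" using assms by real_asymp
    then show "((\<lambda>u. arctan (u / a) / a) \<longlongrightarrow> pi / 2 / a) at_top" 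
      using assms by (intro tendsto_intros) auto
  qed auto
  then show ?thesis by simp
qed

text \<open>Partial fractions, unless \<open>a = b\<close>, which is \<open>nn_integral_inverse_quadratic_square\<close>.
  The integral is over the open half-line because for \<open>b = 0\<close> the integrand, as a total function,
  vanishes at \<open>0\<close> instead of having its limit there.\<close>

lemma nn_integral_inverse_two_quadratics:
  fixes a b :: real
  assumes "a > 0" "0 \<le> b" "b \<le> a"
  shows "(\<integral>\<^sup>+ u. ennreal (2 * u\<^sup>2 / ((u\<^sup>2 + a\<^sup>2) * (u\<^sup>2 + b\<^sup>2))) * indicator {0<..} u \<partial>lborel)
    = ennreal (pi / (a + b))"
proof -
  have *: "(\<integral>\<^sup>+ u. f u * indicator {0<..} u \<partial>lborel) = (\<integral>\<^sup>+ u. f u * indicator {0..} u \<partial>lborel)"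
    for f :: "real \<Rightarrow> ennreal"
    by (intro nn_integral_cong_AE AE_I[where N="{0}"]) (auto simp: indicator_def)
  consider "b = a" | "b < a" using assms by linarith
  then show ?thesis
  proof cases
    case 1
    then show ?thesis
      using nn_integral_inverse_quadratic_square[of 1 a] assms
      by (simp add: * power2_eq_square)
  next
    case 2
    define f where "f = (\<lambda>u. ennreal (2 * u\<^sup>2 / ((u\<^sup>2 + a\<^sup>2) * (u\<^sup>2 + b\<^sup>2))) * indicator {0<..} u)"
    define k where "k = 2 / (a\<^sup>2 - b\<^sup>2)"
    have ab: "a\<^sup>2 - b\<^sup>2 > 0" using 2 assms by (simp add: power_strict_mono)
    have k: "k > 0" using ab by (simp add: k_def)
    have [measurable]: "f \<in> borel_measurable borel" unfolding f_def by measurable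
    have pf: "f u + ennreal (k * b\<^sup>2) * (ennreal (1 / (u\<^sup>2 + b\<^sup>2)) * indicator {0<..} u) =
        ennreal (k * a\<^sup>2) * (ennreal (1 / (u\<^sup>2 + a\<^sup>2)) * indicator {0<..} u)" for u
    proof (cases "u > 0")
      case True
      then have p: "u\<^sup>2 + a\<^sup>2 > 0" "u\<^sup>2 + b\<^sup>2 > 0" by (auto intro: add_pos_nonneg)
      have "2 * u\<^sup>2 / ((u\<^sup>2 + a\<^sup>2) * (u\<^sup>2 + b\<^sup>2)) + k * b\<^sup>2 * (1 / (u\<^sup>2 + b\<^sup>2)) =
        k * a\<^sup>2 * (1 / (u\<^sup>2 + a\<^sup>2))"
      proof -
        define P Q D where "P = u\<^sup>2 + a\<^sup>2" and "Q = u\<^sup>2 + b\<^sup>2" and "D = a\<^sup>2 - b\<^sup>2"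
        have "2 * u\<^sup>2 * D + 2 * b\<^sup>2 * P = 2 * a\<^sup>2 * Q" unfolding P_def Q_def D_def by algebra
        moreover have "P > 0" "Q > 0" "D > 0" using p ab by (auto simp: P_def Q_def D_def)
        ultimately have "2 * u\<^sup>2 / (P * Q) + 2 / D * b\<^sup>2 * (1 / Q) = 2 / D * a\<^sup>2 * (1 / P)"
          by (simp add: field_simps)
        then show ?thesis unfolding P_def Q_def D_def k_def .
      qed
      then show ?thesis using True k p
        by (simp add: f_def ennreal_mult[symmetric] ennreal_plus[symmetric] del: ennreal_plus)
    qed (auto simp: f_def)
    have "(\<integral>\<^sup>+ u. f u \<partial>lborel) + ennreal (k * b\<^sup>2) * (\<integral>\<^sup>+ u. ennreal (1 / (u\<^sup>2 + b\<^sup>2)) * indicator {0<..} u \<partial>lborel)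
      = ennreal (k * a\<^sup>2) * (\<integral>\<^sup>+ u. ennreal (1 / (u\<^sup>2 + a\<^sup>2)) * indicator {0<..} u \<partial>lborel)"
      by (simp add: nn_integral_cmult[symmetric] nn_integral_add[symmetric] pf)
    also have "\<dots> = ennreal (k * a * pi / 2)"
      using assms k
      by (simp add: * nn_integral_inverse_quadratic ennreal_mult[symmetric]) (simp add: power2_eq_square)
    also have "ennreal (k * b\<^sup>2) * (\<integral>\<^sup>+ u. ennreal (1 / (u\<^sup>2 + b\<^sup>2)) * indicator {0<..} u \<partial>lborel)
       = ennreal (k * b * pi / 2)"
      using assms k nn_integral_inverse_quadratic[of b]
      by (cases "b = 0") (simp_all add: * ennreal_mult[symmetric], simp add: power2_eq_square)
    finally have "(\<integral>\<^sup>+ u. f u \<partial>lborel) = ennreal (k * a * pi / 2) - ennreal (k * b * pi / 2)"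
      by (metis ennreal_add_diff_cancel_right ennreal_neq_top)
    also have "\<dots> = ennreal (k * a * pi / 2 - k * b * pi / 2)"
      using assms k by (intro ennreal_minus) auto
    also have "k * a * pi / 2 - k * b * pi / 2 = pi / (a + b)"
    proof -
      define d where "d = a - b"
      have "d > 0" "a + b > 0" using 2 assms by (auto simp: d_def)
      moreover have "k = 2 / ((a + b) * d)"
        by (simp add: k_def d_def algebra_simps power2_eq_square)
      ultimately have kd: "k * d = 2 / (a + b)" by simp
      have "k * a * pi / 2 - k * b * pi / 2 = k * d * pi / 2"
        by (simp add: d_def algebra_simps diff_divide_distrib)
      also have "\<dots> = pi / (a + b)" unfolding kd using \<open>a + b > 0\<close> by (simp add: field_simps)
      finally show ?thesis .
    qed
    finally show ?thesis by (simp add: f_def)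
  qed
qed


section \<open>Products of inverse distances over a sphere\<close>

lemma AE_sphere_area: "AE x in sphere_area c r. norm (x - c) = \<bar>r\<bar>"
proof -
  have "norm (sphere_param c r z - c) = \<bar>r\<bar>" for z
  proof -
    obtain \<theta> \<phi> where z: "z = (\<theta>, \<phi>)" by (cases z)
    define v :: "real^3" where "v = vector [sin \<theta> * cos \<phi>, sin \<theta> * sin \<phi>, cos \<theta>]"
    have "(norm v)\<^sup>2 = (sin \<theta> * cos \<phi>)\<^sup>2 + (sin \<theta> * sin \<phi>)\<^sup>2 + (cos \<theta>)\<^sup>2"
      unfolding power2_norm_eq_inner by (simp add: v_def inner_vec_def sum_3 power2_eq_square)
    also have "\<dots> = (sin \<theta>)\<^sup>2 * ((sin \<phi>)\<^sup>2 + (cos \<phi>)\<^sup>2) + (cos \<theta>)\<^sup>2"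
      by algebra
    finally have "(norm v)\<^sup>2 = 1" by simp
    then have "norm v = 1" unfolding power2_eq_1_iff using norm_ge_zero[of v] by linarith
    then show ?thesis by (simp add: z sphere_param_def v_def)
  qed
  then show ?thesis unfolding sphere_area_def
    by (subst AE_distr_iff) auto
qed

text \<open>Bounding the integral of \<open>1 / (r + d - b \<bullet> (x - c))\<^sup>2\<close>, for a unit vector
  \<open>b\<close> pointing to \<open>y\<close>, from below by the contribution of \<open>y\<close> shows that
  the mass of \<open>y\<close> is of order \<open>d\<close> as \<open>d\<close> tends to \<open>0\<close>.\<close>

lemma emeasure_sphere_area_singleton:
  assumes r: "r > 0"
  shows "emeasure (sphere_area c r) {y} = 0"
proof (cases "norm (y - c) = r")
  case False
  have "AE x in sphere_area c r. \<not> x = y"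
    using AE_sphere_area[of c r] by eventually_elim (use False r in auto)
  from emeasure_eq_0_AE[OF this] show ?thesis by simp
next
  case True
  define m where "m = measure (sphere_area c r) {y}"
  have fin: "emeasure (sphere_area c r) {y} = ennreal m"
  proof -
    have "emeasure (sphere_area c r) {y} \<le> emeasure (sphere_area c r) UNIV"
      by (intro emeasure_mono) auto
    also have "\<dots> < \<infinity>" by (simp add: emeasure_sphere_area_UNIV)
    finally show ?thesis unfolding m_def by (intro emeasure_eq_ennreal_measure) auto
  qed
  define b where "b = (1 / r) *\<^sub>R (y - c)"
  have b: "norm b = 1" "b \<bullet> (y - c) = r"
    using True r by (auto simp: b_def power2_norm_eq_inner[symmetric] power2_eq_square)
  have "m \<le> 0 + e" if e: "e > 0" for e
  proof -
    define d where "d = e / (2 * pi * r)"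
    have d: "d > 0" using e r by (simp add: d_def)
    define S where "S = 4 * pi * r\<^sup>2 / ((r + d)\<^sup>2 - r\<^sup>2)"
    have S: "S = 4 * pi * r\<^sup>2 / (d * (2 * r + d))"
      by (simp add: S_def power2_eq_square algebra_simps)
    have "ennreal (1 / d\<^sup>2) * ennreal m = (\<integral>\<^sup>+ x. ennreal (1 / d\<^sup>2) * indicator {y} x \<partial>sphere_area c r)"
      by (simp add: fin[symmetric] nn_integral_cmult_indicator)
    also have "\<dots> \<le> (\<integral>\<^sup>+ x. ennreal (1 / ((r + d) - b \<bullet> (x - c))\<^sup>2) \<partial>sphere_area c r)"
      by (intro nn_integral_mono) (auto simp: indicator_def b)
    also have "\<dots> = ennreal S"
      unfolding S_def using r d b by (subst nn_integral_inverse_square_sphere) auto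
    finally have "1 / d\<^sup>2 * m \<le> S"
      using r d by (simp add: ennreal_mult[symmetric] m_def S)
    then have "m \<le> d\<^sup>2 * S" using d by (simp add: field_simps)
    also have "\<dots> = 2 * pi * r * d * (2 * r / (2 * r + d))"
      using r d by (simp add: S power2_eq_square)
    also have "\<dots> \<le> 2 * pi * r * d * 1"
      using r d by (intro mult_left_mono) auto
    also have "\<dots> = e" using r by (simp add: d_def)
    finally show ?thesis by simp
  qed
  then have "m \<le> 0" by (rule field_le_epsilon)
  then show ?thesis by (simp add: fin ennreal_neg)
qed

text \<open>On a sphere, squared distances from fixed points are affine functions, so this contains all integrals of
  \<open>1 / (norm (x - p) ^ 3 * norm (x - y))\<close>. Parametrising the product by
  \<open>nn_integral_inverse_quadratic_square\<close> and exchanging integrals leaves over the sphere the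
  inverse square of one affine function. By \<open>nn_integral_inverse_square_sphere\<close> this integral is
  proportional to the reciprocal of the quartic
  \<open>\<alpha>\<^sup>2 * u ^ 4 + 2 * (a1 * a2 - r\<^sup>2 * (b1 \<bullet> b2)) * u\<^sup>2 + \<gamma>\<^sup>2\<close>,
  whose integral against \<open>2 * u\<^sup>2\<close> depends only on \<open>\<alpha>\<close> and
  \<open>K\<close>. The factor with index \<open>2\<close> may vanish at a point of the sphere, which happens
  when \<open>y\<close> lies on it.\<close>

lemma nn_integral_two_affine_factors_sphere:
  fixes b1 b2 c :: "real^3"
  assumes r: "r > 0"
    and a1: "r * norm b1 < a1" and a2: "r * norm b2 \<le> a2"
    and pos: "AE x in sphere_area c r. 0 < a2 - b2 \<bullet> (x - c)"
    and \<alpha>: "\<alpha> > 0" "\<alpha>\<^sup>2 = a1\<^sup>2 - r\<^sup>2 * (norm b1)\<^sup>2"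
    and \<gamma>: "\<gamma> \<ge> 0" "\<gamma>\<^sup>2 = a2\<^sup>2 - r\<^sup>2 * (norm b2)\<^sup>2"
    and K: "K > 0" "K\<^sup>2 = 2 * (a1 * a2 - r\<^sup>2 * (b1 \<bullet> b2)) + 2 * \<alpha> * \<gamma>"
  shows "(\<integral>\<^sup>+ x. ennreal (1 / (sqrt (a1 - b1 \<bullet> (x - c)) ^ 3 * sqrt (a2 - b2 \<bullet> (x - c)))) \<partial>sphere_area c r)
     = ennreal (8 * pi * r\<^sup>2 / (\<alpha> * K))"
proof -
  define A where "A = (\<lambda>x. a1 - b1 \<bullet> (x - c))"
  define B where "B = (\<lambda>x. a2 - b2 \<bullet> (x - c))"
  \<comment> \<open>The quartic is \<open>\<alpha>\<^sup>2 * (u\<^sup>2 + s\<^sup>2) * (u\<^sup>2 + t\<^sup>2)\<close> with \<open>\<alpha> * (s + t) = K\<close> and \<open>\<alpha> * (s - t) = M\<close>.\<close>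
  define M where "M = sqrt (K\<^sup>2 - 4 * \<alpha> * \<gamma>)"
  have a10: "a1 > 0" using r by (intro le_less_trans[OF _ a1]) auto
  have a20: "a2 \<ge> 0" using r by (intro order.trans[OF _ a2]) auto
  have KM: "K\<^sup>2 - 4 * \<alpha> * \<gamma> \<ge> 0"
  proof -
    define n1 where "n1 = r * norm b1"
    define n2 where "n2 = r * norm b2"
    have n: "n1 \<ge> 0" "n2 \<ge> 0" "n1 < a1" "n2 \<le> a2" using r a1 a2 by (auto simp: n1_def n2_def)
    have sq: "\<alpha>\<^sup>2 = a1\<^sup>2 - n1\<^sup>2" "\<gamma>\<^sup>2 = a2\<^sup>2 - n2\<^sup>2" 
      using \<alpha> \<gamma> by (auto simp: n1_def n2_def power_mult_distrib)
    have "n1 * n2 \<le> a1 * a2" using n by (intro mult_mono) auto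
    \<comment> \<open>This is the reversed Cauchy-Schwarz inequality for \<open>(a1, n1)\<close> and \<open>(a2, n2)\<close>
      in the Lorentz form \<open>a\<^sup>2 - n\<^sup>2\<close>.\<close>
    have "(\<alpha> * \<gamma>)\<^sup>2 = (a1 * a2 - n1 * n2)\<^sup>2 - (a1 * n2 - a2 * n1)\<^sup>2"
      unfolding power_mult_distrib sq by algebra
    then have le: "(\<alpha> * \<gamma>)\<^sup>2 \<le> (a1 * a2 - n1 * n2)\<^sup>2" by simp
    have "\<alpha> * \<gamma> \<le> a1 * a2 - n1 * n2"
      by (rule power2_le_imp_le[OF le]) (use \<open>n1 * n2 \<le> a1 * a2\<close> in simp)
    moreover have "r\<^sup>2 * (b1 \<bullet> b2) \<le> r\<^sup>2 * (norm b1 * norm b2)"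
      by (intro mult_left_mono norm_cauchy_schwarz) auto
    ultimately show ?thesis unfolding K(2) by (simp add: n1_def n2_def power2_eq_square mult_ac)
  qed
  have M: "M \<ge> 0" "M\<^sup>2 = K\<^sup>2 - 4 * \<alpha> * \<gamma>" using KM by (auto simp: M_def)
  have MK: "M \<le> K"
  proof (rule power2_le_imp_le)
    have "0 \<le> \<alpha> * \<gamma>" using \<alpha>(1) \<gamma>(1) by simp
    then show "M\<^sup>2 \<le> K\<^sup>2" unfolding M(2) by simp
  qed (use K(1) in simp)
  define s where "s = (K + M) / (2 * \<alpha>)"
  define t where "t = (K - M) / (2 * \<alpha>)"
  have st: "s > 0" "0 \<le> t" "t \<le> s" "s + t = K / \<alpha>"
    using K(1) M(1) MK \<alpha>(1) by (auto simp: s_def t_def field_simps)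
  have st2: "\<alpha> * (s * t) = \<gamma>"
  proof -
    have "4 * \<alpha>\<^sup>2 * (s * t) = K\<^sup>2 - M\<^sup>2" using \<alpha>(1) by (simp add: s_def t_def field_simps power2_eq_square)
    also have "\<dots> = 4 * \<alpha> * \<gamma>" using M(2) by simp
    finally show ?thesis using \<alpha>(1) by (simp add: power2_eq_square)
  qed
  have st3: "\<alpha>\<^sup>2 * (s\<^sup>2 + t\<^sup>2) = 2 * (a1 * a2 - r\<^sup>2 * (b1 \<bullet> b2))"
  proof -
    have "\<alpha>\<^sup>2 * (s\<^sup>2 + t\<^sup>2) = (\<alpha> * (s + t))\<^sup>2 - 2 * \<alpha> * (\<alpha> * (s * t))" by algebra
    also have "\<dots> = K\<^sup>2 - 2 * \<alpha> * \<gamma>" using \<alpha>(1) by (simp add: st(4) st2)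
    finally show ?thesis using K(2) by simp
  qed
  have quartic: "(a1 * u\<^sup>2 + a2)\<^sup>2 - r\<^sup>2 * (norm (u\<^sup>2 *\<^sub>R b1 + b2))\<^sup>2 = \<alpha>\<^sup>2 * ((u\<^sup>2 + s\<^sup>2) * (u\<^sup>2 + t\<^sup>2))" for u
  proof -
    have n: "(norm (u\<^sup>2 *\<^sub>R b1 + b2))\<^sup>2 = u ^ 4 * (norm b1)\<^sup>2 + 2 * u\<^sup>2 * (b1 \<bullet> b2) + (norm b2)\<^sup>2"
      unfolding power2_norm_eq_inner by (simp add: inner_simps inner_commute algebra_simps)
    have "\<alpha>\<^sup>2 * ((u\<^sup>2 + s\<^sup>2) * (u\<^sup>2 + t\<^sup>2)) = \<alpha>\<^sup>2 * u ^ 4 + u\<^sup>2 * (\<alpha>\<^sup>2 * (s\<^sup>2 + t\<^sup>2)) + (\<alpha> * (s * t))\<^sup>2"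
      by algebra
    also have "\<dots> = (a1\<^sup>2 - r\<^sup>2 * (norm b1)\<^sup>2) * u ^ 4 + u\<^sup>2 * (2 * (a1 * a2 - r\<^sup>2 * (b1 \<bullet> b2))) +
       (a2\<^sup>2 - r\<^sup>2 * (norm b2)\<^sup>2)"
      unfolding st2 st3 unfolding \<alpha>(2) \<gamma>(2) ..
    finally show ?thesis unfolding n by (simp add: algebra_simps power2_eq_square power4_eq_xxxx)
  qed
  define f where "f = (\<lambda>x u. ennreal (2 * u\<^sup>2) * ennreal (1 / (A x * u\<^sup>2 + B x)\<^sup>2) * indicator {0<..} u)"
  have [measurable]: "A \<in> borel_measurable borel" "B \<in> borel_measurable borel" 
    unfolding A_def B_def by measurable
  have [measurable]: "(\<lambda>(x, u). f x u) \<in> borel_measurable (sphere_area c r \<Otimes>\<^sub>M lborel)"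
    unfolding f_def by measurable
  have *: "(\<integral>\<^sup>+ u. g u * indicator {0<..} u \<partial>lborel) = (\<integral>\<^sup>+ u. g u * indicator {0..} u \<partial>lborel)"
    for g :: "real \<Rightarrow> ennreal"
    by (intro nn_integral_cong_AE AE_I[where N="{0}"]) (auto simp: indicator_def)
  interpret S: finite_measure "sphere_area c r"
    by standard (simp add: emeasure_sphere_area_UNIV)
  interpret P: pair_sigma_finite "sphere_area c r" lborel ..
  have Apos: "AE x in sphere_area c r. A x > 0"
    using AE_sphere_area[of c r]
  proof eventually_elim
    case (elim x)
    have "b1 \<bullet> (x - c) \<le> norm b1 * norm (x - c)" by (rule norm_cauchy_schwarz)
    then show ?case using elim r a1 by (simp add: A_def mult.commute)
  qed
  have "(\<integral>\<^sup>+ x. ennreal (1 / (sqrt (A x) ^ 3 * sqrt (B x))) \<partial>sphere_area c r)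
    = (\<integral>\<^sup>+ x. ennreal (2 / pi) * (\<integral>\<^sup>+ u. f x u \<partial>lborel) \<partial>sphere_area c r)"
  proof (rule nn_integral_cong_AE, use Apos pos[folded B_def] in eventually_elim)
    case (elim x)
    then have "B x > 0" by (simp add: B_def)
    have "(\<integral>\<^sup>+ u. f x u \<partial>lborel) = (\<integral>\<^sup>+ u. ennreal (2 * u\<^sup>2 / (A x * u\<^sup>2 + B x)\<^sup>2) * indicator {0..} u \<partial>lborel)"
      unfolding f_def * by (simp add: ennreal_mult[symmetric])
    also have "\<dots> = ennreal (pi / (2 * sqrt (A x) ^ 3 * sqrt (B x)))"
      using nn_integral_inverse_quadratic_square[of "sqrt (A x)" "sqrt (B x)"] elim \<open>B x > 0\<close> by simp
    finally show ?case using elim \<open>B x > 0\<close> by (simp add: ennreal_mult[symmetric])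
  qed
  also have "\<dots> = ennreal (2 / pi) * (\<integral>\<^sup>+ u. \<integral>\<^sup>+ x. f x u \<partial>sphere_area c r \<partial>lborel)"
    by (simp add: nn_integral_cmult P.Fubini'[symmetric])
  also have "(\<integral>\<^sup>+ u. \<integral>\<^sup>+ x. f x u \<partial>sphere_area c r \<partial>lborel) =
     (\<integral>\<^sup>+ u. ennreal (4 * pi * r\<^sup>2 / \<alpha>\<^sup>2) * (ennreal (2 * u\<^sup>2 / ((u\<^sup>2 + s\<^sup>2) * (u\<^sup>2 + t\<^sup>2))) * indicator {0<..} u) \<partial>lborel)"
  proof (rule nn_integral_cong)
    fix u :: real
    show "(\<integral>\<^sup>+ x. f x u \<partial>sphere_area c r) =
       ennreal (4 * pi * r\<^sup>2 / \<alpha>\<^sup>2) * (ennreal (2 * u\<^sup>2 / ((u\<^sup>2 + s\<^sup>2) * (u\<^sup>2 + t\<^sup>2))) * indicator {0<..} u)"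
    proof (cases "u > 0")
      case True
      have lt: "r * norm (u\<^sup>2 *\<^sub>R b1 + b2) < a1 * u\<^sup>2 + a2"
      proof -
        have "r * norm (u\<^sup>2 *\<^sub>R b1 + b2) \<le> r * (u\<^sup>2 * norm b1 + norm b2)"
          using r by (intro mult_left_mono order.trans[OF norm_triangle_ineq]) auto
        also have "\<dots> = u\<^sup>2 * (r * norm b1) + r * norm b2" by (simp add: algebra_simps)
        also have "\<dots> < u\<^sup>2 * a1 + a2" using True a1 a2 by (intro add_less_le_mono mult_strict_left_mono) auto
        finally show ?thesis by (simp add: mult.commute)
      qed
      have "A x * u\<^sup>2 + B x = (a1 * u\<^sup>2 + a2) - (u\<^sup>2 *\<^sub>R b1 + b2) \<bullet> (x - c)" for x
        by (simp add: A_def B_def inner_simps algebra_simps)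
      then have "(\<integral>\<^sup>+ x. f x u \<partial>sphere_area c r) = ennreal (2 * u\<^sup>2) *
         (\<integral>\<^sup>+ x. ennreal (1 / ((a1 * u\<^sup>2 + a2) - (u\<^sup>2 *\<^sub>R b1 + b2) \<bullet> (x - c))\<^sup>2) \<partial>sphere_area c r)"
        using True by (simp add: f_def nn_integral_cmult)
      also have "\<dots> = ennreal (2 * u\<^sup>2) * ennreal (4 * pi * r\<^sup>2 / (\<alpha>\<^sup>2 * ((u\<^sup>2 + s\<^sup>2) * (u\<^sup>2 + t\<^sup>2))))"
        by (simp only: nn_integral_inverse_square_sphere[OF r lt] quartic)
      finally show ?thesis using True by (simp add: ennreal_mult[symmetric] mult_ac)
    qed (auto simp: f_def)
  qed
  also have "\<dots> = ennreal (4 * pi * r\<^sup>2 / \<alpha>\<^sup>2) * ennreal (pi / (s + t))"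
    by (simp add: nn_integral_cmult nn_integral_inverse_two_quadratics[OF st(1-3)])
  finally show ?thesis using K(1) \<alpha>(1)
    by (simp add: A_def B_def st(4) ennreal_mult[symmetric] power2_eq_square)
qed


section \<open>The Poisson kernel of a ball\<close>

definition poisson_kernel :: "real^3 \<Rightarrow> real \<Rightarrow> real^3 \<Rightarrow> real^3 \<Rightarrow> real" where
  "poisson_kernel c r p x = (r\<^sup>2 - (norm (p - c))\<^sup>2) / (4 * pi * r * norm (x - p) ^ 3)"

text \<open>The form in which distances enter \<open>nn_integral_two_affine_factors_sphere\<close>.\<close>

lemma norm_diff_on_sphere:
  fixes x c p :: "'a::real_inner"
  assumes "norm (x - c) = r"
  shows "norm (x - p) = sqrt ((r\<^sup>2 + (norm (p - c))\<^sup>2) - (2 *\<^sub>R (p - c)) \<bullet> (x - c))"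
proof -
  have "(norm (x - p))\<^sup>2 = (norm ((x - c) - (p - c)))\<^sup>2" by simp
  also have "\<dots> = (r\<^sup>2 + (norm (p - c))\<^sup>2) - (2 *\<^sub>R (p - c)) \<bullet> (x - c)"
    unfolding assms[symmetric] power2_norm_eq_inner by (simp only: inner_diff_left inner_diff_right inner_scaleR_left) (simp add: inner_commute)
  finally show ?thesis by (metis norm_ge_zero real_sqrt_unique)
qed

text \<open>The case \<open>K = 2 * r * norm (p - y)\<close> of \<open>nn_integral_two_affine_factors_sphere\<close>. It
  includes points \<open>y\<close> on the sphere itself, as it must for densities supported there.\<close>

lemma poisson_kernel_reproduces_Newton:
  assumes r: "r > 0" and p: "p \<in> ball c r" and y: "y \<notin> ball c r"
  shows "(\<integral>\<^sup>+ x. ennreal (poisson_kernel c r p x / norm (x - y)) \<partial>sphere_area c r) = ennreal (1 / norm (p - y))"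
proof -
  define P where "P = norm (p - c)"
  define Y where "Y = norm (y - c)"
  have P: "0 \<le> P" "P < r" and Y: "r \<le> Y" using p y by (auto simp: P_def Y_def dist_norm norm_minus_commute)
  have nP: "norm (2 *\<^sub>R (p - c)) = 2 * P" by (simp add: P_def)
  have sq: "P\<^sup>2 < r\<^sup>2" "r\<^sup>2 \<le> Y\<^sup>2" using P Y r by (auto intro: power_strict_mono power_mono)
  have nY: "norm (2 *\<^sub>R (y - c)) = 2 * Y" by (simp add: Y_def)
  have py: "norm (p - y) > 0" using p y by auto
  have "(\<integral>\<^sup>+ x. ennreal (poisson_kernel c r p x / norm (x - y)) \<partial>sphere_area c r) =
     (\<integral>\<^sup>+ x. ennreal ((r\<^sup>2 - P\<^sup>2) / (4 * pi * r)) * ennreal (1 / (sqrt ((r\<^sup>2 + P\<^sup>2) - (2 *\<^sub>R (p - c)) \<bullet> (x - c)) ^ 3 *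
        sqrt ((r\<^sup>2 + Y\<^sup>2) - (2 *\<^sub>R (y - c)) \<bullet> (x - c)))) \<partial>sphere_area c r)"
  proof (rule nn_integral_cong_AE, use AE_sphere_area[of c r] in eventually_elim)
    case (elim x)
    then have elim: "norm (x - c) = r" using r by simp
    have "poisson_kernel c r p x / norm (x - y) = (r\<^sup>2 - P\<^sup>2) / (4 * pi * r) *
        (1 / (sqrt ((r\<^sup>2 + P\<^sup>2) - (2 *\<^sub>R (p - c)) \<bullet> (x - c)) ^ 3 *
          sqrt ((r\<^sup>2 + Y\<^sup>2) - (2 *\<^sub>R (y - c)) \<bullet> (x - c))))"
      by (simp add: poisson_kernel_def norm_diff_on_sphere[OF elim] P_def Y_def)
    then show ?case using sq(1) r by (simp add: ennreal_mult'[symmetric])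
  qed
  also have "\<dots> = ennreal ((r\<^sup>2 - P\<^sup>2) / (4 * pi * r)) * (\<integral>\<^sup>+ x. ennreal (1 / (sqrt ((r\<^sup>2 + P\<^sup>2) - (2 *\<^sub>R (p - c)) \<bullet> (x - c)) ^ 3 *
        sqrt ((r\<^sup>2 + Y\<^sup>2) - (2 *\<^sub>R (y - c)) \<bullet> (x - c)))) \<partial>sphere_area c r)"
    by (rule nn_integral_cmult) measurable
  also have "\<dots> = ennreal ((r\<^sup>2 - P\<^sup>2) / (4 * pi * r)) * ennreal (8 * pi * r\<^sup>2 / ((r\<^sup>2 - P\<^sup>2) * (2 * r * norm (p - y))))"
  proof (subst nn_integral_two_affine_factors_sphere[where \<alpha>="r\<^sup>2 - P\<^sup>2" and \<gamma>="Y\<^sup>2 - r\<^sup>2" and K="2 * r * norm (p - y)"])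
    show "AE x in sphere_area c r. 0 < r\<^sup>2 + Y\<^sup>2 - (2 *\<^sub>R (y - c)) \<bullet> (x - c)"
    proof -
      have "AE x in sphere_area c r. x \<noteq> y"
        by (rule AE_I[where N="{y}"]) (auto simp: emeasure_sphere_area_singleton r)
      with AE_sphere_area[of c r] show ?thesis
      proof eventually_elim
        case (elim x)
        then have "0 < norm (x - y)" and "norm (x - c) = r" using r by auto
        then show ?case using norm_diff_on_sphere[of x c r y] by (simp add: Y_def)
      qed
    qed
    have "0 < (r - P)\<^sup>2" using P by simp
    then show "r * norm (2 *\<^sub>R (p - c)) < r\<^sup>2 + P\<^sup>2" unfolding nP by (simp add: power2_eq_square algebra_simps)
    have "0 \<le> (r - Y)\<^sup>2" by simp
    then show "r * norm (2 *\<^sub>R (y - c)) \<le> r\<^sup>2 + Y\<^sup>2" unfolding nY by (simp add: power2_eq_square algebra_simps)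
    show "(r\<^sup>2 - P\<^sup>2)\<^sup>2 = (r\<^sup>2 + P\<^sup>2)\<^sup>2 - r\<^sup>2 * (norm (2 *\<^sub>R (p - c)))\<^sup>2"
      unfolding nP by (simp add: power2_eq_square algebra_simps)
    show "(Y\<^sup>2 - r\<^sup>2)\<^sup>2 = (r\<^sup>2 + Y\<^sup>2)\<^sup>2 - r\<^sup>2 * (norm (2 *\<^sub>R (y - c)))\<^sup>2"
      unfolding nY by (simp add: power2_eq_square algebra_simps)
    have "(norm (p - y))\<^sup>2 = (norm ((p - c) - (y - c)))\<^sup>2" by simp
    also have "\<dots> = P\<^sup>2 + Y\<^sup>2 - 2 * ((p - c) \<bullet> (y - c))"
      unfolding P_def Y_def power2_norm_eq_inner by (simp only: inner_diff_left inner_diff_right) (simp add: inner_commute)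
    finally have n: "(norm (p - y))\<^sup>2 = P\<^sup>2 + Y\<^sup>2 - 2 * ((p - c) \<bullet> (y - c))" .
    show "(2 * r * norm (p - y))\<^sup>2 = 2 * ((r\<^sup>2 + P\<^sup>2) * (r\<^sup>2 + Y\<^sup>2) - r\<^sup>2 * ((2 *\<^sub>R (p - c)) \<bullet> (2 *\<^sub>R (y - c)))) +
        2 * (r\<^sup>2 - P\<^sup>2) * (Y\<^sup>2 - r\<^sup>2)"
      unfolding power_mult_distrib n by (simp only: inner_scaleR_left inner_scaleR_right) (simp add: algebra_simps power2_eq_square)
  qed (use r sq py in auto)
  also have "\<dots> = ennreal (1 / norm (p - y))"
    using r sq py by (simp add: ennreal_mult[symmetric] power2_eq_square)
  finally show ?thesis .
qed

text \<open>The limit of \<open>poisson_kernel_reproduces_Newton\<close>, multiplied by \<open>norm y\<close>, as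
  \<open>y\<close> tends to infinity: the second affine factor becomes the constant \<open>1\<close>.\<close>

lemma poisson_kernel_total:
  assumes r: "r > 0" and p: "p \<in> ball c r"
  shows "(\<integral>\<^sup>+ x. ennreal (poisson_kernel c r p x) \<partial>sphere_area c r) = 1"
proof -
  define P where "P = norm (p - c)"
  have P: "0 \<le> P" "P < r" using p by (auto simp: P_def dist_norm norm_minus_commute)
  have nP: "norm (2 *\<^sub>R (p - c)) = 2 * P" by (simp add: P_def)
  have sq: "P\<^sup>2 < r\<^sup>2" using P r by (auto intro: power_strict_mono)
  have "(\<integral>\<^sup>+ x. ennreal (poisson_kernel c r p x) \<partial>sphere_area c r) =
     (\<integral>\<^sup>+ x. ennreal ((r\<^sup>2 - P\<^sup>2) / (4 * pi * r)) * ennreal (1 / (sqrt ((r\<^sup>2 + P\<^sup>2) - (2 *\<^sub>R (p - c)) \<bullet> (x - c)) ^ 3 *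
        sqrt (1 - 0 \<bullet> (x - c)))) \<partial>sphere_area c r)"
  proof (rule nn_integral_cong_AE, use AE_sphere_area[of c r] in eventually_elim)
    case (elim x)
    then have elim: "norm (x - c) = r" using r by simp
    have "poisson_kernel c r p x = (r\<^sup>2 - P\<^sup>2) / (4 * pi * r) *
        (1 / (sqrt ((r\<^sup>2 + P\<^sup>2) - (2 *\<^sub>R (p - c)) \<bullet> (x - c)) ^ 3 * sqrt (1 - 0 \<bullet> (x - c))))"
      by (simp add: poisson_kernel_def norm_diff_on_sphere[OF elim] P_def)
    then show ?case using sq r by (simp add: ennreal_mult'[symmetric])
  qed
  also have "\<dots> = ennreal ((r\<^sup>2 - P\<^sup>2) / (4 * pi * r)) * (\<integral>\<^sup>+ x. ennreal (1 / (sqrt ((r\<^sup>2 + P\<^sup>2) - (2 *\<^sub>R (p - c)) \<bullet> (x - c)) ^ 3 *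
        sqrt (1 - 0 \<bullet> (x - c)))) \<partial>sphere_area c r)"
    by (rule nn_integral_cmult) measurable
  also have "\<dots> = ennreal ((r\<^sup>2 - P\<^sup>2) / (4 * pi * r)) * ennreal (8 * pi * r\<^sup>2 / ((r\<^sup>2 - P\<^sup>2) * (2 * r)))"
  proof (subst nn_integral_two_affine_factors_sphere[where \<alpha>="r\<^sup>2 - P\<^sup>2" and \<gamma>=1 and K="2 * r"])
    have "0 < (r - P)\<^sup>2" using P by simp
    then show "r * norm (2 *\<^sub>R (p - c)) < r\<^sup>2 + P\<^sup>2" unfolding nP by (simp add: power2_eq_square algebra_simps)
    show "(r\<^sup>2 - P\<^sup>2)\<^sup>2 = (r\<^sup>2 + P\<^sup>2)\<^sup>2 - r\<^sup>2 * (norm (2 *\<^sub>R (p - c)))\<^sup>2"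
      unfolding nP by (simp add: power2_eq_square algebra_simps)
  qed (use r sq in \<open>auto simp: power2_eq_square algebra_simps\<close>)
  also have "\<dots> = 1"
    using r sq by (simp add: ennreal_mult[symmetric] power2_eq_square)
  finally show ?thesis .
qed


section \<open>Single layer potentials inside the balls\<close>

lemma finite_measure_sphere_area: "finite_measure (sphere_area c r)"
  by standard (simp add: emeasure_sphere_area_UNIV)

lemma finite_measure_bdry_area: "finite_measure (bdry_area c r)"
  by standard (simp add: emeasure_bdry_area emeasure_sphere_area_UNIV ennreal_plus[symmetric] del: ennreal_plus)

lemma AE_bdry_area_iff:
  assumes "{x. P x} \<in> sets borel"
  shows "(AE x in bdry_area c r. P x) \<longleftrightarrow>
    (AE x in sphere_area (c 1) (r 1). P x) \<and> (AE x in sphere_area (c 2) (r 2). P x)"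
proof -
  have m: "{x. \<not> P x} \<in> sets borel"
    using sets.compl_sets[OF assms] by (simp add: Collect_neg_eq Compl_eq_Diff_UNIV)
  show ?thesis
    using m by (simp add: AE_iff_measurable[OF _ refl] emeasure_bdry_area)
qed

lemma AE_bdry_area_imp_sphere_area:
  assumes "AE x in bdry_area c r. P x" and "i \<in> {1, 2}"
  shows "AE x in sphere_area (c i) (r i). P x"
proof -
  obtain N where N: "{x. \<not> P x} \<subseteq> N" "N \<in> sets borel" "emeasure (bdry_area c r) N = 0"
    using assms(1) by (auto elim: AE_E)
  then have "emeasure (sphere_area (c i) (r i)) N = 0"
    using assms(2) by (auto simp: emeasure_bdry_area)
  with N show ?thesis by (intro AE_I[where N=N]) auto
qed

text \<open>The potential at \<open>p\<close> is the average, with the Poisson kernel as weight, of its boundary values: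
  by Fubini, averaging the potential amounts to averaging the kernels \<open>1 / norm (x - y)\<close>, each of
  which is reproduced because almost every source point \<open>y\<close> lies on or outside the ball. The
  exchange is legitimate because after averaging the kernel is bounded by the reciprocal of the distance of
  \<open>p\<close> from the sphere.\<close>

lemma single_layer_interior:
  fixes c :: "nat \<Rightarrow> real^3"
  assumes r: "r 1 > 0" "r 2 > 0" and sep: "r 1 + r 2 \<le> dist (c 1) (c 2)"
    and \<psi>: "integrable (bdry_area c r) \<psi>"
    and i: "i \<in> {1, 2}"
    and v: "AE x in bdry_area c r. x \<in> frontier (ball (c i) (r i)) \<longrightarrow> single_layer (bdry_area c r) \<psi> x = v"
    and p: "p \<in> ball (c i) (r i)"
  shows "single_layer (bdry_area c r) \<psi> p = v"
proof -
  define S where "S = sphere_area (c i) (r i)"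
  define \<sigma> where "\<sigma> = bdry_area c r"
  define k where "k = poisson_kernel (c i) (r i) p"
  have ri: "r i > 0" using r i by auto
  interpret S: finite_measure S unfolding S_def by (rule finite_measure_sphere_area)
  interpret B: finite_measure \<sigma> unfolding \<sigma>_def by (rule finite_measure_bdry_area)
  interpret P: pair_sigma_finite S \<sigma> ..
  have [measurable_cong]: "sets S = sets borel" "sets \<sigma> = sets borel" by (auto simp: S_def \<sigma>_def)
  have [measurable]: "\<psi> \<in> borel_measurable borel"
    using \<psi> by (auto dest!: borel_measurable_integrable simp: measurable_cong_sets[OF sets_bdry_area refl])
  have [measurable]: "k \<in> borel_measurable borel" unfolding k_def poisson_kernel_def by measurable
  have k0: "k x \<ge> 0" for x
  proof -
    have "norm (p - c i) < r i" using p by (simp add: dist_norm norm_minus_commute)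
    then have "(norm (p - c i))\<^sup>2 \<le> (r i)\<^sup>2" by (intro power_mono) auto
    then show ?thesis using ri by (simp add: k_def poisson_kernel_def)
  qed
  have "(\<integral>\<^sup>+ x. ennreal (k x) \<partial>S) = 1"
    using poisson_kernel_total[OF ri p] by (simp add: k_def S_def)
  then have int_k: "(\<integral> x. k x \<partial>S) = 1"
    using k0 by (subst integral_eq_nn_integral) auto
  have out: "AE y in \<sigma>. y \<notin> ball (c i) (r i)"
  proof -
    have *: "AE y in sphere_area (c j) (r j). y \<notin> ball (c i) (r i)" if j: "j \<in> {1, 2}" for j
      using AE_sphere_area[of "c j" "r j"]
    proof eventually_elim
      case (elim y)
      have rj: "dist y (c j) = r j" using elim r j by (auto simp: dist_norm)
      show ?case
      proof (cases "i = j")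
        case False
        then have "r i + r j \<le> dist (c i) (c j)" using i j sep by (auto simp: dist_commute)
        also have "\<dots> \<le> dist (c i) y + dist y (c j)" by (rule dist_triangle)
        finally show ?thesis using rj by simp
      qed (use rj in \<open>simp add: dist_commute\<close>)
    qed
    show ?thesis unfolding \<sigma>_def
      using *[of 1] *[of 2] by (subst AE_bdry_area_iff) auto
  qed
  define f where "f = (\<lambda>x y. k x * (\<psi> y / norm (x - y)))"
  have [measurable]: "case_prod f \<in> borel_measurable (S \<Otimes>\<^sub>M \<sigma>)" unfolding f_def by measurable
  define \<delta> where "\<delta> = r i - norm (p - c i)"
  have \<delta>: "\<delta> > 0" using p by (simp add: \<delta>_def dist_norm norm_minus_commute)
  have far: "\<delta> \<le> norm (p - y)" if "y \<notin> ball (c i) (r i)" for y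
  proof -
    have "norm (y - c i) \<le> norm (p - c i) + norm (p - y)"
      using norm_triangle_ineq[of "p - c i" "y - p"] by (simp add: norm_minus_commute)
    then show ?thesis using that by (simp add: \<delta>_def dist_norm norm_minus_commute)
  qed
  have nn: "AE y in \<sigma>. (\<integral>\<^sup>+ x. ennreal (k x / norm (x - y)) \<partial>S) = ennreal (1 / norm (p - y))"
    using out by eventually_elim (simp add: k_def S_def poisson_kernel_reproduces_Newton[OF ri p])
  have int: "integrable (S \<Otimes>\<^sub>M \<sigma>) (case_prod f)"
  proof (rule integrableI_bounded)
    have "(\<integral>\<^sup>+ z. ennreal (norm (case_prod f z)) \<partial>(S \<Otimes>\<^sub>M \<sigma>)) =
       (\<integral>\<^sup>+ y. \<integral>\<^sup>+ x. ennreal (norm (f x y)) \<partial>S \<partial>\<sigma>)"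
      by (subst P.nn_integral_snd[symmetric]) auto
    also have "\<dots> = (\<integral>\<^sup>+ y. ennreal \<bar>\<psi> y\<bar> * (\<integral>\<^sup>+ x. ennreal (k x / norm (x - y)) \<partial>S) \<partial>\<sigma>)"
      using k0 by (subst nn_integral_cmult[symmetric])
        (auto simp: f_def abs_mult ennreal_mult[symmetric] mult_ac intro!: nn_integral_cong)
    also have "\<dots> \<le> (\<integral>\<^sup>+ y. ennreal (\<bar>\<psi> y\<bar> * (1 / \<delta>)) \<partial>\<sigma>)"
    proof (rule nn_integral_mono_AE, use nn out in eventually_elim)
      case (elim y)
      have "\<bar>\<psi> y\<bar> * (1 / norm (p - y)) \<le> \<bar>\<psi> y\<bar> * (1 / \<delta>)"
        using far[OF elim(2)] \<delta> by (intro mult_left_mono divide_left_mono mult_pos_pos) auto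
      then show ?case unfolding elim(1) by (simp add: ennreal_mult'[symmetric] ennreal_leI)
    qed
    also have "\<dots> < \<infinity>"
    proof -
      have "integrable \<sigma> (\<lambda>y. \<bar>\<psi> y\<bar> * (1 / \<delta>))" using \<psi> by (simp add: \<sigma>_def)
      then show ?thesis using \<delta> by (subst nn_integral_eq_integral) auto
    qed
    finally show "(\<integral>\<^sup>+ z. ennreal (norm (case_prod f z)) \<partial>(S \<Otimes>\<^sub>M \<sigma>)) < \<infinity>" .
  qed simp
  have vS: "AE x in S. single_layer \<sigma> \<psi> x = v"
    using AE_bdry_area_imp_sphere_area[OF v i] AE_sphere_area[of "c i" "r i"]
    unfolding S_def \<sigma>_def
    by eventually_elim (use ri in \<open>auto simp: dist_norm norm_minus_commute\<close>)
  have "v = (\<integral> x. k x * v \<partial>S)" using int_k by simp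
  also have "\<dots> = (\<integral> x. k x * single_layer \<sigma> \<psi> x \<partial>S)"
  proof (rule integral_cong_AE)
    show "(\<lambda>x. k x * single_layer \<sigma> \<psi> x) \<in> borel_measurable S"
      unfolding single_layer_def by measurable
    show "AE x in S. k x * v = k x * single_layer \<sigma> \<psi> x"
      using vS by eventually_elim simp
  qed measurable
  also have "\<dots> = - (1 / (4 * pi)) * (\<integral> x. \<integral> y. f x y \<partial>\<sigma> \<partial>S)"
    by (simp add: single_layer_def f_def flip: integral_mult_right_zero)
  also have "(\<integral> x. \<integral> y. f x y \<partial>\<sigma> \<partial>S) = (\<integral> y. \<integral> x. f x y \<partial>S \<partial>\<sigma>)"
    by (rule P.Fubini_integral[OF int, symmetric])
  also have "\<dots> = (\<integral> y. \<psi> y / norm (p - y) \<partial>\<sigma>)"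
  proof (rule integral_cong_AE)
    show "AE y in \<sigma>. (\<integral> x. f x y \<partial>S) = \<psi> y / norm (p - y)"
      using nn
    proof eventually_elim
      case (elim y)
      have "(\<integral> x. f x y \<partial>S) = \<psi> y * (\<integral> x. k x / norm (x - y) \<partial>S)"
        by (simp add: f_def mult_ac flip: integral_mult_right_zero)
      also have "(\<integral> x. k x / norm (x - y) \<partial>S) = 1 / norm (p - y)"
        using elim k0 by (subst integral_eq_nn_integral) auto
      finally show ?case by simp
    qed
  qed measurable
  finally show ?thesis by (simp add: single_layer_def \<sigma>_def)
qed


section \<open>Image charges on the axis of two spheres\<close>

text \<open>The centre of the sphere \<open>\<eta>\<close> of the bispherical coordinate system with foci
  \<open>m - \<alpha> *\<^sub>R e\<close> and \<open>m + \<alpha> *\<^sub>R e\<close>, for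
  \<open>\<alpha> > 0\<close>; the radius of that sphere is \<open>\<alpha> / \<bar>sinh \<eta>\<bar>\<close>.\<close>

definition image_point :: "'a::real_inner \<Rightarrow> 'a \<Rightarrow> real \<Rightarrow> real \<Rightarrow> 'a" where
  "image_point m e \<alpha> \<eta> = m + (\<alpha> * (cosh \<eta> / sinh \<eta>)) *\<^sub>R e"

lemma image_point_minus: "image_point m e \<alpha> (- \<eta>) = image_point m (- e) \<alpha> \<eta>"
  by (simp add: image_point_def)

text \<open>For \<open>x\<close> on the sphere \<open>\<xi>\<close>, the scaled distance depends on \<open>\<eta>\<close>
  only through the product \<open>sinh \<eta> * sinh (\<eta> - \<xi>)\<close>, which is invariant under
  \<open>\<eta> \<mapsto> \<xi> - \<eta>\<close>. This is why the coordinate \<open>\<eta>\<close> is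
  convenient: the reflection represents inversion in the sphere.\<close>

lemma dist_image_point_on_sphere:
  fixes m e x :: "'a::real_inner"
  assumes e: "norm e = 1" and \<xi>: "sinh \<xi> \<noteq> 0" and \<eta>: "sinh \<eta> \<noteq> 0"
    and x: "norm (x - image_point m e \<alpha> \<xi>) = \<bar>\<alpha> / sinh \<xi>\<bar>"
  shows "(sinh \<eta> * norm (x - image_point m e \<alpha> \<eta>))\<^sup>2
    = \<alpha>\<^sup>2 + 2 * \<alpha> * ((x - m) \<bullet> e) * (sinh \<eta> * sinh (\<eta> - \<xi>) / sinh \<xi>)"
proof -
  define X where "X = (x - m) \<bullet> e"
  define w where "w = (x - m) \<bullet> (x - m)"
  have n: "(norm (x - image_point m e \<alpha> \<eta>))\<^sup>2 = w - 2 * (\<alpha> * (cosh \<eta> / sinh \<eta>)) * X + (\<alpha> * (cosh \<eta> / sinh \<eta>))\<^sup>2" for \<eta>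
  proof -
    have ee: "e \<bullet> e = 1" using e by (simp add: norm_eq_1)
    have "(norm ((x - m) - k *\<^sub>R e))\<^sup>2 = w - 2 * k * X + k\<^sup>2" for k
      unfolding power2_norm_eq_inner inner_diff_left[of "x - m"] inner_diff_right[of _ "x - m"]
      by (simp add: ee X_def w_def inner_commute[of e "x - m"] power2_eq_square)
    then show ?thesis by (simp add: image_point_def diff_diff_eq)
  qed
  have hyp: "(cosh t)\<^sup>2 = (sinh t)\<^sup>2 + 1" for t :: real by (rule cosh_square_eq)
  have "w - 2 * (\<alpha> * (cosh \<xi> / sinh \<xi>)) * X + (\<alpha> * (cosh \<xi> / sinh \<xi>))\<^sup>2 = (\<alpha> / sinh \<xi>)\<^sup>2"
    unfolding n[of \<xi>, symmetric] x by (rule power2_abs)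
  then have "w = 2 * \<alpha> * X * (cosh \<xi> / sinh \<xi>) + \<alpha>\<^sup>2 * ((1 - (cosh \<xi>)\<^sup>2) / (sinh \<xi>)\<^sup>2)"
    by (simp add: power_divide power_mult_distrib algebra_simps diff_divide_distrib)
  then have w: "w = 2 * \<alpha> * X * (cosh \<xi> / sinh \<xi>) - \<alpha>\<^sup>2" using \<xi> by (simp add: hyp)
  have "(sinh \<eta> * norm (x - image_point m e \<alpha> \<eta>))\<^sup>2 =
     (sinh \<eta>)\<^sup>2 * (2 * \<alpha> * X * (cosh \<xi> / sinh \<xi>) - \<alpha>\<^sup>2 - 2 * (\<alpha> * (cosh \<eta> / sinh \<eta>)) * X + (\<alpha> * (cosh \<eta> / sinh \<eta>))\<^sup>2)"
    unfolding power_mult_distrib n w ..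
  also have "\<dots> = 2 * \<alpha> * X * ((sinh \<eta>)\<^sup>2 * (cosh \<xi> / sinh \<xi>) - sinh \<eta> * cosh \<eta>) + \<alpha>\<^sup>2 * ((cosh \<eta>)\<^sup>2 - (sinh \<eta>)\<^sup>2)"
    using \<eta> by (simp add: power2_eq_square algebra_simps)
  also have "(cosh \<eta>)\<^sup>2 - (sinh \<eta>)\<^sup>2 = 1" by (simp add: hyp)
  also have "(sinh \<eta>)\<^sup>2 * (cosh \<xi> / sinh \<xi>) - sinh \<eta> * cosh \<eta> = sinh \<eta> * sinh (\<eta> - \<xi>) / sinh \<xi>"
    using \<xi> by (simp add: sinh_diff power2_eq_square field_simps)
  finally show ?thesis by (simp add: X_def)
qed

text \<open>By the symmetry of \<open>dist_image_point_on_sphere\<close>, charges of size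
  \<open>\<alpha> / \<bar>sinh \<eta>\<bar>\<close> at \<open>\<eta>\<close> and at its mirror image
  \<open>\<xi> - \<eta>\<close> have equal potentials on the sphere \<open>\<xi>\<close>, so that they cancel
  there when given opposite signs.\<close>

lemma image_charge_cancels:
  fixes m e x :: "'a::real_inner"
  assumes "norm e = 1" and "sinh \<xi> \<noteq> 0" and "sinh \<eta> \<noteq> 0" and "sinh (\<xi> - \<eta>) \<noteq> 0"
    and "norm (x - image_point m e \<alpha> \<xi>) = \<bar>\<alpha> / sinh \<xi>\<bar>"
  shows "\<bar>\<alpha> / sinh (\<xi> - \<eta>)\<bar> / norm (x - image_point m e \<alpha> (\<xi> - \<eta>)) = \<bar>\<alpha> / sinh \<eta>\<bar> / norm (x - image_point m e \<alpha> \<eta>)"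
proof -
  have s: "sinh (\<eta> - \<xi>) = - sinh (\<xi> - \<eta>)" using sinh_minus[of "\<xi> - \<eta>"] by simp
  have "(sinh (\<xi> - \<eta>) * norm (x - image_point m e \<alpha> (\<xi> - \<eta>)))\<^sup>2 = (sinh \<eta> * norm (x - image_point m e \<alpha> \<eta>))\<^sup>2"
    unfolding dist_image_point_on_sphere[OF assms(1,2,3,5)] dist_image_point_on_sphere[OF assms(1,2,4,5)]
    by (simp add: s mult_ac)
  then have "\<bar>sinh (\<xi> - \<eta>)\<bar> * norm (x - image_point m e \<alpha> (\<xi> - \<eta>)) = \<bar>sinh \<eta>\<bar> * norm (x - image_point m e \<alpha> \<eta>)"
    by (metis real_sqrt_abs abs_mult abs_norm_cancel)
  then show ?thesis by simp
qed

lemma image_point_in_ball: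
  assumes "norm e = 1" and "0 < \<xi>" and "\<xi> \<le> \<eta>" and "\<alpha> > 0"
  shows "image_point m e \<alpha> \<eta> \<in> ball (image_point m e \<alpha> \<xi>) (\<alpha> / sinh \<xi>)"
proof -
  have s: "sinh \<xi> > 0" "sinh \<eta> > 0" using assms by auto
  have "image_point m e \<alpha> \<xi> - image_point m e \<alpha> \<eta> = (\<alpha> * (cosh \<xi> / sinh \<xi>) - \<alpha> * (cosh \<eta> / sinh \<eta>)) *\<^sub>R e"
    by (simp add: image_point_def scaleR_diff_left)
  also have "\<alpha> * (cosh \<xi> / sinh \<xi>) - \<alpha> * (cosh \<eta> / sinh \<eta>) = \<alpha> * (sinh (\<eta> - \<xi>) / (sinh \<xi> * sinh \<eta>))"
    using s by (simp add: sinh_diff field_simps)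
  finally have "dist (image_point m e \<alpha> \<xi>) (image_point m e \<alpha> \<eta>) = \<alpha> * (sinh (\<eta> - \<xi>) / (sinh \<xi> * sinh \<eta>))"
    using assms s by (simp add: dist_norm)
  also have "\<dots> < \<alpha> * (sinh \<eta> / (sinh \<xi> * sinh \<eta>))"
    using assms s by (intro mult_strict_left_mono divide_strict_right_mono) auto
  also have "\<dots> = \<alpha> / sinh \<xi>" using s by simp
  finally show ?thesis by simp
qed

text \<open>The value of \<open>\<alpha>\<close> is dictated by the requirement that the centres, at signed distances
  \<open>- \<alpha> * coth \<xi>i\<close> and \<open>\<alpha> * coth \<xi>j\<close> from \<open>m\<close>, are
  \<open>D = ri + rj + \<epsilon>\<close> apart. Since
  \<open>\<alpha> * coth \<xi>i = sqrt (ri\<^sup>2 + \<alpha>\<^sup>2)\<close>, the plane through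
  \<open>m\<close> perpendicular to the axis is the radical plane of the two spheres, whose distances from the
  centres are \<open>(D\<^sup>2 + ri\<^sup>2 - rj\<^sup>2) / (2 * D)\<close> and its counterpart.\<close>

lemma bispherical_centres:
  fixes ci cj :: "'a::real_inner"
  assumes r: "ri > 0" "rj > 0" and \<epsilon>: "\<epsilon> > 0" and d: "dist ci cj = ri + rj + \<epsilon>"
    and \<alpha>: "\<alpha> = sqrt (\<epsilon> * (2 * ri + \<epsilon>) * (2 * rj + \<epsilon>) * (2 * ri + 2 * rj + \<epsilon>)) / (2 * (ri + rj + \<epsilon>))"
    and \<xi>: "\<xi>i = arsinh (\<alpha> / ri)" "\<xi>j = arsinh (\<alpha> / rj)"
  obtains m e where "norm e = 1" and "\<alpha> > 0" and "\<xi>i > 0" and "\<xi>j > 0"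
    and "ci = image_point m e \<alpha> (- \<xi>i)" and "cj = image_point m e \<alpha> \<xi>j"
    and "ri = \<alpha> / sinh \<xi>i" and "rj = \<alpha> / sinh \<xi>j"
proof -
  define D where "D = ri + rj + \<epsilon>"
  have D: "D > 0" using r \<epsilon> by (simp add: D_def)
  have P: "\<epsilon> * (2 * ri + \<epsilon>) * (2 * rj + \<epsilon>) * (2 * ri + 2 * rj + \<epsilon>) > 0"
    using r \<epsilon> by (intro mult_pos_pos) auto
  then have \<alpha>0: "\<alpha> > 0" using D by (simp add: \<alpha> D_def)
  have \<alpha>2: "4 * D\<^sup>2 * \<alpha>\<^sup>2 = \<epsilon> * (2 * ri + \<epsilon>) * (2 * rj + \<epsilon>) * (2 * ri + 2 * rj + \<epsilon>)"
    using P D unfolding \<alpha> D_def[symmetric] by (simp add: power_divide power_mult_distrib)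
  have sh: "sinh \<xi>i = \<alpha> / ri" "sinh \<xi>j = \<alpha> / rj" by (simp_all add: \<xi> sinh_arsinh_real)
  have \<xi>0: "\<xi>i > 0" "\<xi>j > 0" using sh \<alpha>0 r by (metis divide_pos_pos sinh_real_pos_iff)+
  have ch: "t * cosh x = (D\<^sup>2 + t\<^sup>2 - u\<^sup>2) / (2 * D)"
    if x: "sinh x = \<alpha> / t" and t: "t > 0" "u > 0" and tu: "4 * D\<^sup>2 * \<alpha>\<^sup>2 + 4 * D\<^sup>2 * t\<^sup>2 = (D\<^sup>2 + t\<^sup>2 - u\<^sup>2)\<^sup>2"
      and pos: "u < D" for t u x
  proof -
    have "(t * cosh x)\<^sup>2 = t\<^sup>2 * (sinh x)\<^sup>2 + t\<^sup>2" by (simp add: power_mult_distrib cosh_square_eq algebra_simps)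
    also have "\<dots> = \<alpha>\<^sup>2 + t\<^sup>2" using t by (simp add: x power_divide)
    also have "\<dots> = (4 * D\<^sup>2 * \<alpha>\<^sup>2 + 4 * D\<^sup>2 * t\<^sup>2) / (2 * D)\<^sup>2" using D by (simp add: field_simps)
    also have "\<dots> = ((D\<^sup>2 + t\<^sup>2 - u\<^sup>2) / (2 * D))\<^sup>2" unfolding tu by (simp add: power_divide)
    finally have sq: "(t * cosh x)\<^sup>2 = ((D\<^sup>2 + t\<^sup>2 - u\<^sup>2) / (2 * D))\<^sup>2" .
    have "u\<^sup>2 \<le> D\<^sup>2" using t pos by (intro power_mono) auto
    then have "0 \<le> D\<^sup>2 + t\<^sup>2 - u\<^sup>2" using zero_le_power2[of t] by linarith
    then show ?thesis using sq t D by (intro power2_eq_imp_eq[OF sq]) auto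
  qed
  have chi: "ri * cosh \<xi>i = (D\<^sup>2 + ri\<^sup>2 - rj\<^sup>2) / (2 * D)"
  proof (rule ch[OF sh(1) r])
    show "4 * D\<^sup>2 * \<alpha>\<^sup>2 + 4 * D\<^sup>2 * ri\<^sup>2 = (D\<^sup>2 + ri\<^sup>2 - rj\<^sup>2)\<^sup>2"
      unfolding \<alpha>2 unfolding D_def by algebra
  qed (use r \<epsilon> in \<open>simp add: D_def\<close>)
  have chj: "rj * cosh \<xi>j = (D\<^sup>2 + rj\<^sup>2 - ri\<^sup>2) / (2 * D)"
  proof (rule ch[OF sh(2) r(2,1)])
    show "4 * D\<^sup>2 * \<alpha>\<^sup>2 + 4 * D\<^sup>2 * rj\<^sup>2 = (D\<^sup>2 + rj\<^sup>2 - ri\<^sup>2)\<^sup>2"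
      unfolding \<alpha>2 unfolding D_def by algebra
  qed (use r \<epsilon> in \<open>simp add: D_def\<close>)
  have sum: "ri * cosh \<xi>i + rj * cosh \<xi>j = D"
    unfolding chi chj using D by (simp add: field_simps power2_eq_square)
  define e where "e = (1 / D) *\<^sub>R (cj - ci)"
  have D': "norm (cj - ci) = D" using d by (simp add: D_def dist_norm norm_minus_commute)
  show thesis
  proof (rule that[of e "ci + (ri * cosh \<xi>i) *\<^sub>R e"])
    show "norm e = 1" using D by (simp add: e_def D')
    show "ci = image_point (ci + (ri * cosh \<xi>i) *\<^sub>R e) e \<alpha> (- \<xi>i)"
      using \<alpha>0 r by (simp add: image_point_def sh)
    have "image_point (ci + (ri * cosh \<xi>i) *\<^sub>R e) e \<alpha> \<xi>j = ci + (ri * cosh \<xi>i + rj * cosh \<xi>j) *\<^sub>R e"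
      using \<alpha>0 r by (simp add: image_point_def sh scaleR_add_left mult.commute)
    then show "cj = image_point (ci + (ri * cosh \<xi>i) *\<^sub>R e) e \<alpha> \<xi>j"
      using D by (simp add: sum e_def)
  qed (use \<alpha>0 \<xi>0 sh r in auto)
qed


section \<open>Charge on one of the spheres\<close>

text \<open>The first charge, at the centre of the \<open>i\<close>-th ball, produces the potential \<open>1\<close> on
  its boundary. Reflecting alternately in the two spheres gives positive charges at \<open>- a n\<close> in
  the \<open>i\<close>-th ball and negative ones at \<open>b n\<close> in the \<open>j\<close>-th ball. Finite
  partial sums suffice: after an equal number of steps in both balls the potential is exactly \<open>0\<close>
  on the \<open>j\<close>-th sphere, and on the \<open>i\<close>-th one it misses the value \<open>1\<close>
  by the potential of the last charge in the \<open>j\<close>-th ball. That error tends to \<open>0\<close>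
  uniformly, because the charges decay while the distance between the balls is fixed; convergence of the
  series is thus part of the conclusion.\<close>

lemma sphere_charge_sums:
  fixes c :: "nat \<Rightarrow> real^3" and m e :: "real^3"
  assumes ij: "{i, j} = {1, 2}"
    and e: "norm e = 1" and \<alpha>: "\<alpha> > 0" and \<xi>: "\<xi>i > 0" "\<xi>j > 0"
    and ci: "c i = image_point m e \<alpha> (- \<xi>i)" and cj: "c j = image_point m e \<alpha> \<xi>j"
    and ri: "r i = \<alpha> / sinh \<xi>i" and rj: "r j = \<alpha> / sinh \<xi>j"
    and sep: "r i + r j < dist (c i) (c j)"
    and \<psi>: "integrable (bdry_area c r) \<psi>"
    and vi: "\<And>p. p \<in> ball (c i) (r i) \<Longrightarrow> single_layer (bdry_area c r) \<psi> p = vi"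
    and vj: "\<And>p. p \<in> ball (c j) (r j) \<Longrightarrow> single_layer (bdry_area c r) \<psi> p = vj"
  shows "(\<lambda>n. - 4 * pi * \<alpha> * (vi / sinh (\<xi>i + real n * (\<xi>i + \<xi>j)) - vj / sinh (real (Suc n) * (\<xi>i + \<xi>j))))
    sums (LINT y : frontier (ball (c i) (r i)) | bdry_area c r. \<psi> y)"
proof -
  define \<sigma> where "\<sigma> = bdry_area c r"
  define s where "s = \<xi>i + \<xi>j"
  define a where "a = (\<lambda>n. \<xi>i + real n * s)"
  define b where "b = (\<lambda>n. real (Suc n) * s)"
  define p where "p = (\<lambda>n. image_point m e \<alpha> (- a n))"
  define q where "q = (\<lambda>n. image_point m e \<alpha> (b n))"
  \<comment> \<open>Potentials at \<open>x\<close> of the \<open>n\<close>-th charges in the two balls, both taken with positive sign.\<close>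
  define T where "T = (\<lambda>n x. \<alpha> / sinh (a n) / norm (x - p n))"
  define T' where "T' = (\<lambda>n x. \<alpha> / sinh (b n) / norm (x - q n))"
  have s: "s > 0" using \<xi> by (simp add: s_def)
  have a: "a n \<ge> \<xi>i" for n using s by (simp add: a_def)
  have b: "b n \<ge> \<xi>j" for n
  proof -
    have "1 * s \<le> b n" unfolding b_def using s by (intro mult_right_mono) auto
    then show ?thesis using \<xi> by (simp add: s_def)
  qed
  have a0: "a n > 0" and b0: "b n > 0" for n
    using \<xi> a[of n] b[of n] by (auto intro: less_le_trans)
  have r0: "r i > 0" "r j > 0" using \<alpha> \<xi> by (auto simp: ri rj)
  then have r12: "r 1 > 0" "r 2 > 0" using ij by (auto simp: doubleton_eq_iff)
  have ball_p: "p n \<in> ball (c i) (r i)" for n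
    unfolding p_def ci ri image_point_minus
    using e \<xi> a[of n] \<alpha> by (intro image_point_in_ball) auto
  have ball_q: "q n \<in> ball (c j) (r j)" for n
    unfolding q_def cj rj using e \<xi> b[of n] \<alpha> by (intro image_point_in_ball) auto
  have disj: "norm (x - c j) \<noteq> r j" if "norm (x - c i) = r i" for x
    using that sep dist_triangle[of "c i" "c j" x] by (auto simp: dist_norm norm_minus_commute)
  have on: "AE x in \<sigma>. norm (x - c i) = r i \<or> norm (x - c j) = r j"
  proof -
    have "AE x in sphere_area (c k) (r k). norm (x - c i) = r i \<or> norm (x - c j) = r j" if "k \<in> {i, j}" for k
      using AE_sphere_area[of "c k" "r k"] by eventually_elim (use that r0 in auto)
    then show ?thesis unfolding \<sigma>_def ij by (subst AE_bdry_area_iff) auto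
  qed
  have Ti: "T (Suc n) x = T' n x" if "norm (x - c i) = r i" for n x
  proof -
    have "- \<xi>i - b n = - a (Suc n)" by (simp add: a_def b_def)
    then have "\<bar>\<alpha> / sinh (- a (Suc n))\<bar> / norm (x - p (Suc n)) = \<bar>\<alpha> / sinh (b n)\<bar> / norm (x - q n)"
      using image_charge_cancels[of e "- \<xi>i" "b n" x m \<alpha>] that e \<xi> b0[of n] a0[of "Suc n"] \<alpha>
      by (simp add: ci ri p_def q_def)
    then show ?thesis using \<alpha> a0[of "Suc n"] b0[of n] by (simp add: T_def T'_def)
  qed
  have Tj: "T n x = T' n x" if "norm (x - c j) = r j" for n x
  proof -
    have "\<xi>j - (- a n) = b n" by (simp add: a_def b_def s_def algebra_simps)
    then have "\<bar>\<alpha> / sinh (b n)\<bar> / norm (x - q n) = \<bar>\<alpha> / sinh (- a n)\<bar> / norm (x - p n)"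
      using image_charge_cancels[of e "\<xi>j" "- a n" x m \<alpha>] that e \<xi> b0[of n] a0[of n] \<alpha>
      by (simp add: cj rj p_def q_def)
    then show ?thesis using \<alpha> a0[of n] b0[of n] by (simp add: T_def T'_def)
  qed
  have T0: "T 0 x = 1" if "norm (x - c i) = r i" for x
    using that \<alpha> \<xi> by (simp add: T_def p_def a_def ci ri)
  \<comment> \<open>On the first sphere each charge \<open>b n\<close> is cancelled by the next charge \<open>a (Suc n)\<close>, on the second
    one by \<open>a n\<close>.\<close>
  have Ui: "(\<Sum>n<Suc N. T n x - T' n x) = 1 - T' N x" if "norm (x - c i) = r i" for N x
    by (induction N) (simp_all add: T0[OF that] Ti[OF that])
  have Uj: "(\<Sum>n<Suc N. T n x - T' n x) = 0" if "norm (x - c j) = r j" for N x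
    by (simp add: Tj[OF that])
  have meas: "\<psi> \<in> borel_measurable borel"
    using \<psi> by (auto dest!: borel_measurable_integrable simp: measurable_cong_sets[OF sets_bdry_area refl])
  note [measurable] = meas
  have [measurable_cong]: "sets \<sigma> = sets borel" by (simp add: \<sigma>_def)
  have [measurable]: "{x. norm (x - c i) = r i} \<in> sets borel" by measurable
  have int\<psi>: "integrable \<sigma> \<psi>" using \<psi> by (simp add: \<sigma>_def)
  have far: "r k - norm (z - c k) \<le> norm (x - z)" if "norm (x - c i) = r i \<or> norm (x - c j) = r j"
      "z \<in> ball (c k) (r k)" "k \<in> {i, j}" for x z k
  proof -
    have "r k \<le> norm (x - c k)"
      using that sep dist_triangle[of "c i" "c j" x] by (auto simp: dist_norm norm_minus_commute)
    then show ?thesis using norm_triangle_ineq[of "x - z" "z - c k"] by simp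
  qed
  have int: "integrable \<sigma> (\<lambda>x. \<psi> x / norm (x - z))"
    and val: "(\<integral> x. \<psi> x / norm (x - z) \<partial>\<sigma>) = - 4 * pi * single_layer \<sigma> \<psi> z"
    if z: "z \<in> ball (c k) (r k)" "k \<in> {i, j}" for z k
  proof -
    define \<delta> where "\<delta> = r k - norm (z - c k)"
    have \<delta>: "\<delta> > 0" using z by (simp add: \<delta>_def dist_norm norm_minus_commute)
    show "integrable \<sigma> (\<lambda>x. \<psi> x / norm (x - z))"
    proof (rule Bochner_Integration.integrable_bound)
      show "integrable \<sigma> (\<lambda>x. \<psi> x * (1 / \<delta>))" using int\<psi> by (rule integrable_mult_left)
      show "AE x in \<sigma>. norm (\<psi> x / norm (x - z)) \<le> norm (\<psi> x * (1 / \<delta>))"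
        using on
      proof eventually_elim
        case (elim x)
        have "\<delta> \<le> norm (x - z)" unfolding \<delta>_def by (rule far[OF elim z])
        then have "\<bar>\<psi> x\<bar> * (1 / norm (x - z)) \<le> \<bar>\<psi> x\<bar> * (1 / \<delta>)"
          using \<delta> by (intro mult_left_mono divide_left_mono mult_pos_pos) auto
        then show ?case using \<delta> by (simp add: abs_mult)
      qed
    qed measurable
    show "(\<integral> x. \<psi> x / norm (x - z) \<partial>\<sigma>) = - 4 * pi * single_layer \<sigma> \<psi> z"
      by (simp add: single_layer_def norm_minus_commute)
  qed
  define d where "d = dist (c i) (c j) - r i - r j"
  have d: "d > 0" using sep by (simp add: d_def)
  define I where "I = (\<lambda>x. indicator {x. norm (x - c i) = r i} x :: real)"
  have [measurable]: "I \<in> borel_measurable borel" unfolding I_def by measurable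
  have T'_bound: "\<bar>I x * T' N x * \<psi> x\<bar> \<le> \<alpha> / sinh (b N) / d * \<bar>\<psi> x\<bar>" for N x
  proof (cases "norm (x - c i) = r i")
    case True
    have "dist (c i) (c j) \<le> norm (x - c i) + norm (x - q N) + norm (q N - c j)"
      using dist_triangle[of "c i" "c j" x] dist_triangle[of x "c j" "q N"]
      by (simp add: dist_norm norm_minus_commute)
    moreover have "norm (q N - c j) \<le> r j"
      using ball_q[of N] by (simp add: dist_norm norm_minus_commute)
    ultimately have "d \<le> norm (x - q N)" using True by (simp add: d_def)
    then have "\<alpha> / sinh (b N) / norm (x - q N) \<le> \<alpha> / sinh (b N) / d"
      using d \<alpha> b0[of N] by (intro divide_left_mono mult_pos_pos) auto
    then have "\<alpha> / sinh (b N) / norm (x - q N) * \<bar>\<psi> x\<bar> \<le> \<alpha> / sinh (b N) / d * \<bar>\<psi> x\<bar>"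
      by (rule mult_right_mono) simp
    then show ?thesis using True \<alpha> b0[of N] by (simp add: I_def T'_def abs_mult)
  next
    case False
    then show ?thesis using d \<alpha> b0[of N] by (simp add: I_def)
  qed
  define L where "L = (\<integral> x. I x * \<psi> x \<partial>\<sigma>)"
  define R where "R = (\<lambda>N. \<integral> x. I x * T' N x * \<psi> x \<partial>\<sigma>)"
  have intI: "integrable \<sigma> (\<lambda>x. I x * \<psi> x)"
    by (rule Bochner_Integration.integrable_bound[OF int\<psi>]) (auto simp: I_def indicator_def)
  have [measurable]: "T' N \<in> borel_measurable borel" for N unfolding T'_def by measurable
  have intR: "integrable \<sigma> (\<lambda>x. I x * T' N x * \<psi> x)" for N
  proof (rule Bochner_Integration.integrable_bound)
    show "integrable \<sigma> (\<lambda>x. \<alpha> / sinh (b N) / d * \<bar>\<psi> x\<bar>)"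
      using int\<psi> by (intro integrable_mult_right integrable_abs)
    show "AE x in \<sigma>. norm (I x * T' N x * \<psi> x) \<le> norm (\<alpha> / sinh (b N) / d * \<bar>\<psi> x\<bar>)"
      using T'_bound d \<alpha> b0[of N] by (intro always_eventually allI) (metis abs_ge_self order_trans real_norm_def)
  qed measurable
  have R_bound: "norm (R N) \<le> \<alpha> / sinh (b N) * ((\<integral> x. \<bar>\<psi> x\<bar> \<partial>\<sigma>) / d)" for N
  proof -
    have "norm (R N) \<le> (\<integral> x. norm (I x * T' N x * \<psi> x) \<partial>\<sigma>)" unfolding R_def by (rule integral_norm_bound)
    also have "\<dots> \<le> (\<integral> x. \<alpha> / sinh (b N) / d * \<bar>\<psi> x\<bar> \<partial>\<sigma>)"
      using T'_bound intR int\<psi> by (intro integral_mono integrable_mult_right integrable_abs integrable_norm) (auto simp del: norm_mult)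
    also have "\<dots> = \<alpha> / sinh (b N) * ((\<integral> x. \<bar>\<psi> x\<bar> \<partial>\<sigma>) / d)" by simp
    finally show ?thesis .
  qed
  have "(\<lambda>N. \<alpha> / sinh (b N)) \<longlonglongrightarrow> 0" unfolding b_def using s by real_asymp
  then have "(\<lambda>N. \<alpha> / sinh (b N) * ((\<integral> x. \<bar>\<psi> x\<bar> \<partial>\<sigma>) / d)) \<longlonglongrightarrow> 0"
    by (rule tendsto_mult_left_zero)
  then have R0: "R \<longlonglongrightarrow> 0"
    by (rule Lim_null_comparison[OF always_eventually[OF allI[OF R_bound]]])
  have partial: "(\<Sum>n<Suc N. - 4 * pi * \<alpha> * (vi / sinh (a n) - vj / sinh (b n))) = L - R N" for N
  proof -
    have "L - R N = (\<integral> x. I x * \<psi> x - I x * T' N x * \<psi> x \<partial>\<sigma>)"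
      unfolding L_def R_def using intI intR by (rule Bochner_Integration.integral_diff[symmetric])
    also have "\<dots> = (\<integral> x. (\<Sum>n<Suc N. \<alpha> / sinh (a n) * (\<psi> x / norm (x - p n)) - \<alpha> / sinh (b n) * (\<psi> x / norm (x - q n))) \<partial>\<sigma>)"
    proof (rule integral_cong_AE)
      show "AE x in \<sigma>. I x * \<psi> x - I x * T' N x * \<psi> x =
          (\<Sum>n<Suc N. \<alpha> / sinh (a n) * (\<psi> x / norm (x - p n)) - \<alpha> / sinh (b n) * (\<psi> x / norm (x - q n)))"
        using on
      proof eventually_elim
        case (elim x)
        have "(\<Sum>n<Suc N. \<alpha> / sinh (a n) * (\<psi> x / norm (x - p n)) - \<alpha> / sinh (b n) * (\<psi> x / norm (x - q n)))
          = (\<Sum>n<Suc N. T n x - T' n x) * \<psi> x"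
          unfolding sum_distrib_right by (intro sum.cong refl) (simp add: T_def T'_def left_diff_distrib)
        also have "\<dots> = I x * \<psi> x - I x * T' N x * \<psi> x"
        proof (cases "norm (x - c i) = r i")
          case True
          then show ?thesis unfolding Ui[OF True] by (simp add: I_def left_diff_distrib)
        next
          case False
          then show ?thesis using elim by (simp add: I_def Uj del: sum.lessThan_Suc)
        qed
        finally show ?case by simp
      qed
    qed measurable
    also have "\<dots> = (\<Sum>n<Suc N. \<alpha> / sinh (a n) * (- 4 * pi * vi) - \<alpha> / sinh (b n) * (- 4 * pi * vj))"
    proof -
      have ip: "integrable \<sigma> (\<lambda>x. \<psi> x / norm (x - p n))" and iq: "integrable \<sigma> (\<lambda>x. \<psi> x / norm (x - q n))" for n
        using int[OF ball_p[of n]] int[OF ball_q[of n]] by auto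
      have vp: "(\<integral> x. \<psi> x / norm (x - p n) \<partial>\<sigma>) = - 4 * pi * vi" for n
        using val[OF ball_p[of n]] vi[OF ball_p[of n]] by (simp add: \<sigma>_def)
      have vq: "(\<integral> x. \<psi> x / norm (x - q n) \<partial>\<sigma>) = - 4 * pi * vj" for n
        using val[OF ball_q[of n]] vj[OF ball_q[of n]] by (simp add: \<sigma>_def)
      show ?thesis
      proof (subst Bochner_Integration.integral_sum)
        show "integrable \<sigma> (\<lambda>x. \<alpha> / sinh (a n) * (\<psi> x / norm (x - p n)) - \<alpha> / sinh (b n) * (\<psi> x / norm (x - q n)))" for n
          by (intro Bochner_Integration.integrable_diff integrable_mult_right ip iq)
        show "(\<Sum>n<Suc N. \<integral> x. \<alpha> / sinh (a n) * (\<psi> x / norm (x - p n)) - \<alpha> / sinh (b n) * (\<psi> x / norm (x - q n)) \<partial>\<sigma>)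
          = (\<Sum>n<Suc N. \<alpha> / sinh (a n) * (- 4 * pi * vi) - \<alpha> / sinh (b n) * (- 4 * pi * vj))"
          by (intro sum.cong refl)
            (simp only: Bochner_Integration.integral_diff[OF integrable_mult_right[OF ip] integrable_mult_right[OF iq]]
              integral_mult_right_zero vp vq)
      qed
    qed
    also have "\<dots> = (\<Sum>n<Suc N. - 4 * pi * \<alpha> * (vi / sinh (a n) - vj / sinh (b n)))"
      by (intro sum.cong refl) (simp add: algebra_simps)
    finally show ?thesis by simp
  qed
  have "(\<lambda>N. \<Sum>n<Suc N. - 4 * pi * \<alpha> * (vi / sinh (a n) - vj / sinh (b n))) \<longlonglongrightarrow> L"
    unfolding partial using tendsto_diff[OF tendsto_const R0, of L] by simp
  then have "(\<lambda>n. - 4 * pi * \<alpha> * (vi / sinh (a n) - vj / sinh (b n))) sums L"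
    unfolding sums_def by (rule LIMSEQ_imp_Suc)
  moreover have "L = (LINT y : frontier (ball (c i) (r i)) | bdry_area c r. \<psi> y)"
  proof -
    have "frontier (ball (c i) (r i)) = {x. norm (x - c i) = r i}"
      using r0 by (auto simp: dist_norm norm_minus_commute)
    then show ?thesis by (simp add: L_def I_def \<sigma>_def set_lebesgue_integral_def)
  qed
  ultimately show ?thesis by (simp add: a_def b_def s_def)
qed


section \<open>From hyperbolic sines to Lambert series\<close>

lemma sums_swap_nonneg:
  fixes h :: "nat \<Rightarrow> nat \<Rightarrow> real"
  assumes nonneg: "\<And>m n. 0 \<le> h m n"
    and f: "\<And>n. (\<lambda>m. h m n) sums f n" and g: "\<And>m. (\<lambda>n. h m n) sums g m" and L: "f sums L"
  shows "g sums L"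
proof -
  have fh: "((\<lambda>m. h m n) has_sum f n) UNIV" and gh: "((\<lambda>n. h m n) has_sum g m) UNIV" for m n
    using f g nonneg by (auto intro!: sums_nonneg_imp_has_sum)
  have "0 \<le> f n" for n by (rule sums_le[OF _ sums_zero f]) (rule nonneg)
  then have Lh: "(f has_sum L) UNIV" using L by (intro sums_nonneg_imp_has_sum) auto
  have "(\<lambda>(n, m). h m n) summable_on (UNIV \<times> UNIV)"
    using fh Lh nonneg by (intro summable_on_SigmaI[where g=f]) (auto dest: has_sum_imp_summable)
  then have "((\<lambda>(n, m). h m n) has_sum L) (UNIV \<times> UNIV)"
    using fh Lh by (intro has_sum_SigmaI[where g=f]) auto
  then have "((\<lambda>(m, n). h m n) has_sum L) (UNIV \<times> UNIV)"
    by (subst has_sum_swap) (simp add: case_prod_unfold)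
  then have "(g has_sum L) UNIV"
    by (rule has_sum_SigmaD) (simp add: gh)
  then show ?thesis by (rule has_sum_imp_sums)
qed

lemma inverse_sinh_sums:
  fixes x :: real
  assumes "x > 0"
  shows "(\<lambda>m. 2 * exp (- (2 * real m + 1) * x)) sums (1 / sinh x)"
proof -
  have "(\<lambda>m. 2 * exp (- x) * exp (- 2 * x) ^ m) sums (2 * exp (- x) * (1 / (1 - exp (- 2 * x))))"
    using assms by (intro sums_mult geometric_sums) auto
  also have "(\<lambda>m. 2 * exp (- x) * exp (- 2 * x) ^ m) = (\<lambda>m. 2 * exp (- (2 * real m + 1) * x))"
    by (simp add: fun_eq_iff exp_of_nat_mult[symmetric] exp_add[symmetric] algebra_simps)
  also have "2 * exp (- x) * (1 / (1 - exp (- 2 * x))) = 1 / sinh x"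
  proof -
    have "exp (- 2 * x) = exp (- x) * exp (- x)" by (simp add: exp_add[symmetric])
    moreover have "exp x * exp (- x) = 1" by (simp add: exp_add[symmetric])
    moreover have "exp (- x) * exp (- x) < 1" using assms by (simp add: exp_add[symmetric])
    moreover have "exp (- x) < exp x" using assms by simp
    ultimately show ?thesis by (simp add: sinh_field_def field_simps)
  qed
  finally show ?thesis .
qed

text \<open>Both sides are the sum of \<open>2 * exp (- (2 * m + 1) * (b + n * s))\<close> over all \<open>m\<close> and
  \<open>n\<close>, taken first over \<open>m\<close> or first over \<open>n\<close>.\<close>

lemma Lambert_sums_sinh:
  fixes b s L :: real
  assumes b: "b > 0" and s: "s > 0" and L: "(\<lambda>n. 1 / sinh (b + real n * s)) sums L"
  shows "(\<lambda>m. 2 * exp ((2 * real m + 1) * (s - b)) / (exp ((2 * real m + 1) * s) - 1)) sums L"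
proof (rule sums_swap_nonneg[OF _ _ _ L])
  show "(\<lambda>m. 2 * exp (- (2 * real m + 1) * (b + real n * s))) sums (1 / sinh (b + real n * s))" for n
    using b s by (intro inverse_sinh_sums) (auto intro: add_pos_nonneg)
  show "(\<lambda>n. 2 * exp (- (2 * real m + 1) * (b + real n * s))) sums
      (2 * exp ((2 * real m + 1) * (s - b)) / (exp ((2 * real m + 1) * s) - 1))" for m
  proof -
    define k where "k = 2 * real m + 1"
    have k: "k > 0" by (simp add: k_def)
    have "(\<lambda>n. 2 * exp (- k * b) * exp (- k * s) ^ n) sums (2 * exp (- k * b) * (1 / (1 - exp (- k * s))))"
      using k s by (intro sums_mult geometric_sums) auto
    also have "(\<lambda>n. 2 * exp (- k * b) * exp (- k * s) ^ n) = (\<lambda>n. 2 * exp (- k * (b + real n * s)))"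
      by (simp add: fun_eq_iff exp_of_nat_mult[symmetric] exp_add[symmetric] algebra_simps)
    also have "2 * exp (- k * b) * (1 / (1 - exp (- k * s))) = 2 * exp (k * (s - b)) / (exp (k * s) - 1)"
    proof -
      have e1: "exp (k * (s - b)) = exp (- k * b) * exp (k * s)"
        by (simp add: exp_add[symmetric] algebra_simps)
      have e2: "exp (- k * s) = 1 / exp (k * s)" by (simp add: exp_minus field_simps)
      have "2 * G * (1 / (1 - 1 / E)) = 2 * (G * E) / (E - 1)" if "E > 1" for E G :: real
        using that by (simp add: field_simps)
      moreover have "exp (k * s) > 1" using k s by simp
      ultimately show ?thesis unfolding e1 e2 by blast
    qed
    finally show ?thesis by (simp add: k_def)
  qed
qed simp


section \<open>The capacitance coefficients\<close>

text \<open>The two cases of \<open>sphere_charge_sums\<close>: with the density \<open>\<psi> i\<close> only the charges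
  in the \<open>i\<close>-th ball count, with \<open>\<psi> j\<close> only those in the other one. Stated for
  an ordered pair of balls, so that exchanging them gives the remaining two coefficients.\<close>

lemma capacitance_coeff_sums:
  fixes c :: "nat \<Rightarrow> real^3"
  assumes ij: "{i, j} = {1, 2}" and r: "r i > 0" "r j > 0" and \<epsilon>: "\<epsilon> > 0"
    and d: "dist (c i) (c j) = r i + r j + \<epsilon>"
    and \<psi>: "capacitance_densities c r \<psi>"
    and \<alpha>: "\<alpha> = sqrt (\<epsilon> * (2 * r i + \<epsilon>) * (2 * r j + \<epsilon>) * (2 * r i + 2 * r j + \<epsilon>)) / (2 * (r i + r j + \<epsilon>))"
    and \<xi>: "\<xi>i = arsinh (\<alpha> / r i)" "\<xi>j = arsinh (\<alpha> / r j)"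
  shows "(\<lambda>n. 8 * pi * \<alpha> * (exp ((2 * real n + 1) * \<xi>j) / (exp ((2 * real n + 1) * (\<xi>i + \<xi>j)) - 1)))
      sums capacitance_coeff c r \<psi> i i"
    and "(\<lambda>n. - 8 * pi * \<alpha> * (1 / (exp ((2 * real n + 1) * (\<xi>i + \<xi>j)) - 1)))
      sums capacitance_coeff c r \<psi> i j"
proof -
  obtain m e where e: "norm e = 1" and \<alpha>0: "\<alpha> > 0" and \<xi>0: "\<xi>i > 0" "\<xi>j > 0"
    and geo: "c i = image_point m e \<alpha> (- \<xi>i)" "c j = image_point m e \<alpha> \<xi>j" "r i = \<alpha> / sinh \<xi>i" "r j = \<alpha> / sinh \<xi>j"
    using bispherical_centres[OF r \<epsilon> d \<alpha> \<xi>] by metis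
  have ne: "i \<noteq> j" and mem: "i \<in> {1, 2}" "j \<in> {1, 2}" using ij by (auto simp: doubleton_eq_iff)
  have r12: "r 1 > 0" "r 2 > 0" using r ij by (auto simp: doubleton_eq_iff)
  have "dist (c 1) (c 2) = r 1 + r 2 + \<epsilon>" using d ij by (auto simp: doubleton_eq_iff dist_commute)
  then have sep12: "r 1 + r 2 \<le> dist (c 1) (c 2)" using \<epsilon> by simp
  have sep: "r i + r j < dist (c i) (c j)" using d \<epsilon> by simp
  have charge: "(\<lambda>n. - 4 * pi * \<alpha> * ((if i = k then 1 else 0) / sinh (\<xi>i + real n * (\<xi>i + \<xi>j)) -
        (if j = k then 1 else 0) / sinh (real (Suc n) * (\<xi>i + \<xi>j))))
      sums (- capacitance_coeff c r \<psi> i k)" if k: "k \<in> {1, 2}" for k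
  proof -
    interpret B: finite_measure "bdry_area c r" by (rule finite_measure_bdry_area)
    have int: "integrable (bdry_area c r) (\<psi> k)"
    proof (rule B.square_integrable_imp_integrable)
      have "square_integrable (bdry_area c r) (\<psi> k)"
        using \<psi> k unfolding capacitance_densities_def by blast
      then show "\<psi> k \<in> borel_measurable (bdry_area c r)" "integrable (bdry_area c r) (\<lambda>x. (\<psi> k x)\<^sup>2)"
        by (simp_all add: square_integrable_def)
    qed
    have pot: "single_layer (bdry_area c r) (\<psi> k) p = (if l = k then 1 else 0)"
      if l: "l \<in> {1, 2}" and p: "p \<in> ball (c l) (r l)" for l p
      by (rule single_layer_interior[OF r12 sep12 int l _ p])
        (use \<psi> k l in \<open>auto simp: capacitance_densities_def\<close>)
    show ?thesis
      using sphere_charge_sums[OF ij e \<alpha>0 \<xi>0 geo sep int pot[OF mem(1)] pot[OF mem(2)]]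
      by (simp add: capacitance_coeff_def)
  qed
  have s: "\<xi>i + \<xi>j > 0" using \<xi>0 by simp
  have "(\<lambda>n. 1 / sinh (\<xi>i + real n * (\<xi>i + \<xi>j))) sums (capacitance_coeff c r \<psi> i i / (4 * pi * \<alpha>))"
    using sums_divide[OF charge[OF mem(1)], of "- (4 * pi * \<alpha>)"] ne \<alpha>0 by simp
  from sums_mult[OF Lambert_sums_sinh[OF \<xi>0(1) s this], of "4 * pi * \<alpha>"]
  show "(\<lambda>n. 8 * pi * \<alpha> * (exp ((2 * real n + 1) * \<xi>j) / (exp ((2 * real n + 1) * (\<xi>i + \<xi>j)) - 1)))
      sums capacitance_coeff c r \<psi> i i"
    using \<alpha>0 by (simp add: mult_ac)
  have "(\<lambda>n. 1 / sinh ((\<xi>i + \<xi>j) + real n * (\<xi>i + \<xi>j))) sums (- (capacitance_coeff c r \<psi> i j / (4 * pi * \<alpha>)))"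
    using sums_divide[OF charge[OF mem(2)], of "4 * pi * \<alpha>"] ne \<alpha>0 by (simp add: algebra_simps)
  from sums_mult[OF Lambert_sums_sinh[OF s s this], of "- 4 * pi * \<alpha>"]
  show "(\<lambda>n. - 8 * pi * \<alpha> * (1 / (exp ((2 * real n + 1) * (\<xi>i + \<xi>j)) - 1)))
      sums capacitance_coeff c r \<psi> i j"
    using \<alpha>0 by (simp add: mult_ac)
qed

theorem lemma4p3:
  fixes c :: "nat \<Rightarrow> real^3" and r \<xi> :: "nat \<Rightarrow> real" and \<epsilon> \<alpha> :: real
    and \<psi> :: "nat \<Rightarrow> real^3 \<Rightarrow> real"
  assumes "r 1 > 0" and "r 2 > 0" and "\<epsilon> > 0"
    and "dist (c 1) (c 2) = r 1 + r 2 + \<epsilon>"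
    and "capacitance_densities c r \<psi>"
    and "\<alpha> = sqrt (\<epsilon> * (2 * r 1 + \<epsilon>) * (2 * r 2 + \<epsilon>) * (2 * r 1 + 2 * r 2 + \<epsilon>))
               / (2 * (r 1 + r 2 + \<epsilon>))"
    and "\<And>i. i \<in> {1, 2} \<Longrightarrow> \<xi> i = arsinh (\<alpha> / r i)"
  shows "((\<lambda>n::nat. 8 * pi * \<alpha> * (exp ((2 * real n + 1) * \<xi> 2)
            / (exp ((2 * real n + 1) * (\<xi> 1 + \<xi> 2)) - 1))) sums capacitance_coeff c r \<psi> 1 1)
    \<and> ((\<lambda>n::nat. 8 * pi * \<alpha> * (exp ((2 * real n + 1) * \<xi> 1)
            / (exp ((2 * real n + 1) * (\<xi> 1 + \<xi> 2)) - 1))) sums capacitance_coeff c r \<psi> 2 2)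
    \<and> ((\<lambda>n::nat. - 8 * pi * \<alpha> * (1
            / (exp ((2 * real n + 1) * (\<xi> 1 + \<xi> 2)) - 1))) sums capacitance_coeff c r \<psi> 1 2)
    \<and> capacitance_coeff c r \<psi> 1 2 = capacitance_coeff c r \<psi> 2 1"
proof -
  have d21: "dist (c 2) (c 1) = r 2 + r 1 + \<epsilon>" using assms(4) by (simp add: dist_commute)
  have \<alpha>21: "\<alpha> = sqrt (\<epsilon> * (2 * r 2 + \<epsilon>) * (2 * r 1 + \<epsilon>) * (2 * r 2 + 2 * r 1 + \<epsilon>))
               / (2 * (r 2 + r 1 + \<epsilon>))"
    unfolding assms(6) by (simp add: ac_simps)
  note \<xi> = assms(7)[OF insertI1] assms(7)[OF insertI2[OF singletonI]]
  note C12 = capacitance_coeff_sums[where i=1 and j=2, OF refl assms(1-6) \<xi>]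
  note C21 = capacitance_coeff_sums[where i=2 and j=1, OF insert_commute assms(2,1,3) d21 assms(5) \<alpha>21 \<xi>(2,1)]
  have "capacitance_coeff c r \<psi> 1 2 = capacitance_coeff c r \<psi> 2 1"
    using sums_unique2[OF C12(2)] C21(2) by (simp add: add.commute)
  with C12 C21(1) show ?thesis by (simp add: add.commute)
qed

end
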